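(* Let $$\mathcal{G}(t;x,u,v,q,z)=\sum_{n=1}^{\infty}t^n\sum_{\pi\in\mathfrak{S}_n}\frac{u^{\mathsf{des}(\pi)}x^{\mathsf{ides}(\pi)}q^{\mathsf{lmin}(\pi)}v^{\mathsf{rmax}(\pi)}z^{\mathsf{lmax}(\pi)}}{(1-u)^n(1-x)^n}.$$ Put $r=1-t$ and, for $n\ge 1$, $\mathcal{T}_n=r^{n-1}\,\mathcal{G}(t;xr^{n-1},u,v,1,1)$. The generating function $\mathcal{G}(t;x,u,v,1,z)$ of permutations counted by the quadruple $(\mathsf{des},\mathsf{ides},\mathsf{rmax},\mathsf{lmax})$ of Euler-Stirling statistics equals $$\mathcal{G}(t;x,u,v,1,z)=\sum_{n=1}^{\infty}\frac{ztv\,r^{n-1}(1+ux\,\mathcal{T}_n)}{u(xr^{n-1}-1)}\prod_{i=1}^{n-1}\frac{t(1-z)r^{i-1}+r^i-1}{u(r^i-1)}$$ $$\times\left(1-\sum_{n=1}^{\infty}\frac{t(z-1)r^{n-1}}{u(r^n-1)}\prod_{i=1}^{n-1}\frac{t(1-z)r^{i-1}+r^i-1}{u(r^i-1)}\right)^{-1}.$$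
   Context: $\mathfrak{S}_n$ is the set of permutations $\pi=\pi_1\pi_2\cdots\pi_n$ of $[n]=\{1,\dots,n\}$. $\mathsf{des}(\pi)=|\{i\in[n-1]:\pi_i>\pi_{i+1}\}|$ is the number of descents; $\mathsf{ides}(\pi)=\mathsf{des}(\pi^{-1})$ is the number of inverse descents; $\mathsf{lmax}(\pi)=|\{\pi_i:\pi_i>\pi_j\text{ for all }j<i\}|$ is the number of left-to-right maxima; $\mathsf{lmin}(\pi)=|\{\pi_i:\pi_i<\pi_j\text{ for all }j<i\}|$ is the number of left-to-right minima; $\mathsf{rmax}(\pi)=|\{\pi_i:\pi_i>\pi_j\text{ for all }j>i\}|$ is the number of right-to-left maxima. A statistic is called Eulerian (respectively Stirling) if its distribution over permutations is given by the Eulerian numbers (respectively the signless Stirling numbers of the first kind); $\mathsf{des},\mathsf{ides}$ are Eulerian and $\mathsf{lmax},\mathsf{lmin},\mathsf{rmax}$ are Stirling. Empty products equal $1$. The series $\mathcal{G}(t;x,u,v,1,1)$ entering $\mathcal{T}_n$ (with $x$ replaced by $xr^{n-1}$) is given by either of the two equivalent forms $$\mathcal{G}(t;x,u,v,1,1)=\sum_{m=1}^{\infty}\frac{vtu^{m-1}}{(1-t)^m-x}\prod_{i=1}^{m-1}\frac{x-(1-t)^i-xvt}{x-(1-t)^i}=\sum_{m=1}^{\infty}\frac{vt(1-t)^{m-1}}{u^{m}(x(1-t)^{m-1}-1)}\prod_{i=1}^{m}\frac{1-x(1-t)^{i-1}}{x(1-t)^{i-1}(vt-1)+1}.$$ 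*)

theory Defs
  imports
    "HOL-Combinatorics.Permutations"
    "HOL-Computational_Algebra.Formal_Laurent_Series"
begin

text \<open>
  A permutation of \<open>[n] = {1..n}\<close> is a function \<open>p\<close> with \<open>p permutes {1..n}\<close>;
  the \<open>i\<close>-th letter of its one-line notation is \<open>p i\<close>.
\<close>

definition des :: "nat \<Rightarrow> (nat \<Rightarrow> nat) \<Rightarrow> nat" where
  "des n p = card {i \<in> {1..<n}. p i > p (Suc i)}"

definition ides :: "nat \<Rightarrow> (nat \<Rightarrow> nat) \<Rightarrow> nat" where
  "ides n p = des n (inv p)"

definition lmax :: "nat \<Rightarrow> (nat \<Rightarrow> nat) \<Rightarrow> nat" where
  "lmax n p = card {p i | i. i \<in> {1..n} \<and> (\<forall>j\<in>{1..n}. j < i \<longrightarrow> p i > p j)}"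

definition lmin :: "nat \<Rightarrow> (nat \<Rightarrow> nat) \<Rightarrow> nat" where
  "lmin n p = card {p i | i. i \<in> {1..n} \<and> (\<forall>j\<in>{1..n}. j < i \<longrightarrow> p i < p j)}"

definition rmax :: "nat \<Rightarrow> (nat \<Rightarrow> nat) \<Rightarrow> nat" where
  "rmax n p = card {p i | i. i \<in> {1..n} \<and> (\<forall>j\<in>{1..n}. j > i \<longrightarrow> p i > p j)}"

text \<open>
  The parameters \<open>x, u, v, q, z\<close> are themselves power series in \<open>t\<close>, so that substitutions such
  as \<open>x \<mapsto> x (1 - t)^(n-1)\<close> are plain instantiations. The quotient is a genuine one as long
  as \<open>u\<close> and \<open>x\<close> have constant terms different from \<open>1\<close>.
\<close>

definition gf_summand ::
    "'k::field fps \<Rightarrow> 'k fps \<Rightarrow> 'k fps \<Rightarrow> 'k fps \<Rightarrow> 'k fps \<Rightarrow> nat \<Rightarrow> 'k fps" where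
  "gf_summand x u v q z n =
     (\<Sum>p | p permutes {1..n}.
        (u ^ des n p * x ^ ides n p * q ^ lmin n p * v ^ rmax n p * z ^ lmax n p)
          / ((1 - u) ^ n * (1 - x) ^ n))"

text \<open>The infinite sum is taken in the \<open>t\<close>-adic topology, where it always converges (see below).\<close>

definition gf ::
    "'k::field fps \<Rightarrow> 'k fps \<Rightarrow> 'k fps \<Rightarrow> 'k fps \<Rightarrow> 'k fps \<Rightarrow> 'k fps" where
  "gf x u v q z = (\<Sum>n. fps_X ^ Suc n * gf_summand x u v q z (Suc n))"

lemma fps_X_power_series_sums:
  fixes c :: "nat \<Rightarrow> 'k::field fps"
  shows "(\<lambda>n. fps_X ^ Suc n * c n) sums Abs_fps (\<lambda>k. \<Sum>n<k. fps_nth (c n) (k - Suc n))"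
  unfolding sums_def
proof (rule tendsto_fpsI)
  fix k
  show "\<forall>\<^sub>F N in sequentially. fps_nth (\<Sum>n<N. fps_X ^ Suc n * c n) k =
          fps_nth (Abs_fps (\<lambda>k. \<Sum>n<k. fps_nth (c n) (k - Suc n))) k"
  proof (rule eventually_sequentiallyI[of k])
    fix N assume "k \<le> N"
    then have "(\<Sum>n<N. fps_nth (fps_X ^ Suc n * c n) k) =
               (\<Sum>n<k. fps_nth (fps_X ^ Suc n * c n) k)"
      by (intro sum.mono_neutral_right) (auto simp: fps_X_power_mult_nth simp del: power_Suc)
    then show "fps_nth (\<Sum>n<N. fps_X ^ Suc n * c n) k =
          fps_nth (Abs_fps (\<lambda>k. \<Sum>n<k. fps_nth (c n) (k - Suc n))) k"
      by (simp add: fps_sum_nth fps_X_power_mult_nth del: power_Suc)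
  qed
qed

lemma gf_sums: "(\<lambda>n. fps_X ^ Suc n * gf_summand x u v q z (Suc n)) sums gf x u v q z"
  unfolding gf_def using fps_X_power_series_sums by (rule summable_sums[OF sums_summable])

lemma gf_nth:
  "fps_nth (gf x u v q z) k = (\<Sum>n<k. fps_nth (gf_summand x u v q z (Suc n)) (k - Suc n))"
  unfolding gf_def sums_unique[OF fps_X_power_series_sums, symmetric] by (rule fps_nth_Abs_fps)

text \<open>
  A series of power series in \<open>t\<close> summed coefficient by coefficient, each coefficient being
  summed in the \<open>1/u\<close>-adic topology of \<open>K((1/u))\<close>. This is weaker than \<open>t\<close>-adic convergence and
  is needed for series whose terms do not tend to \<open>0\<close> \<open>t\<close>-adically, like
  the sum over \<open>n\<close> of \<open>u^(-n)\<close>.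
\<close>

definition coeffwise_sums ::
    "(nat \<Rightarrow> 'a::field fls fps) \<Rightarrow> 'a fls fps \<Rightarrow> bool" where
  "coeffwise_sums f s \<longleftrightarrow> (\<forall>k. (\<lambda>n. fps_nth (f n) k) sums fps_nth s k)"

text \<open>
  \<open>K((1/u))\<close> is rendered as \<open>'a fls\<close>, whose variable \<open>fls_X\<close> plays the role of \<open>1/u\<close>; hence
  \<open>u\<close> is \<open>fls_X_inv\<close>. It contains the field \<open>K(u)\<close> of rational functions in \<open>u\<close>.
  The other variables are represented by elements of the arbitrary field \<open>K\<close>; taking for \<open>K\<close> a field
  of rational functions in them gives the identity with all variables formal.
\<close>

abbreviation indet_u :: "'a::field fls fps" where
  "indet_u \<equiv> fps_const fls_X_inv"

abbreviation scalar :: "'a::field \<Rightarrow> 'a fls fps" where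
  "scalar c \<equiv> fps_const (fls_const c)"

end

theory Submission
  imports Defs
begin

text \<open>
  Standardization turns permutations with inverse descents weighted by \<open>x\<close> into words over the
  letters \<open>0, \<dots>, l\<close>, with \<open>l\<close> marked by \<open>x\<close>. Splitting a word at the last occurrence of its largest
  letter, \<open>w = \<alpha> m \<beta>\<close>, sends the left-to-right maxima to \<open>\<alpha>\<close>, the right-to-left maxima to \<open>\<beta>\<close> and
  adds up descents. Solving the resulting recurrences in \<open>l\<close> shows that the generating
  functions \<open>a(l)\<close> of the words with largest letter \<open>l\<close> satisfy, with \<open>c = 1 - z t\<close>,
  \<open>(c r^(l+1) - u) a(l+1) = (r^(l+1) - u + v t u) a(l)\<close>. Summed against \<open>x^l\<close> this is the functional equation
  \<open>u (1 - x + x v t) G(x) = (c - x r) G(x r) - v z t\<close>.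

  Let \<open>p(m) = P(m+1)\<close> and \<open>B(x) = u G1(x) - r G1(x r)\<close>, where \<open>G1\<close> is \<open>G\<close> at \<open>z = 1\<close>. By the functional
  equation, the summand of the numerator is \<open>(z/u) p(m) r^m B(x r^m)\<close>, the denominator is
  \<open>(1 - 1/u) (\<Sum>m. p(m))\<close>, and the numerator satisfies, by a telescoping sum, the functional equation
  of \<open>G\<close> multiplied by the denominator. Dividing by \<open>u\<close> makes the functional equation contracting in
  the \<open>1/u\<close>-adic topology, so its solution is unique.
\<close>

section \<open>Binomial transforms\<close>

text \<open>The transform is unitriangular: in row \<open>l\<close> the coefficient of
  \<open>f l\<close> is 1 and the other entries are known by induction.\<close>

lemma binomial_transform_inject:
  fixes f g :: "nat \<Rightarrow> 'a::comm_ring_1"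
  assumes "\<And>l. (\<Sum>s\<le>l. of_nat (l choose s) * f s) = (\<Sum>s\<le>l. of_nat (l choose s) * g s)"
  shows "f l = g l"
proof (induction l rule: less_induct)
  case (less l)
  have "(\<Sum>s<l. of_nat (l choose s) * f s) = (\<Sum>s<l. of_nat (l choose s) * g s)"
    using less by (intro sum.cong) auto
  with assms[of l] show ?case
    by (simp flip: lessThan_Suc_atMost)
qed

text \<open>Pascal's rule. Passing from \<open>A l\<close> to \<open>A (Suc l)\<close> becomes, on
  the untransformed side, adding the shifted sequence.\<close>

lemma binomial_transform_shift:
  fixes f :: "nat \<Rightarrow> 'a::comm_ring_1"
  shows "(\<Sum>s\<le>l. of_nat (l choose s) * (f s + f (Suc s))) =
    (\<Sum>s\<le>Suc l. of_nat (Suc l choose s) * f s)"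
proof -
  have "(\<Sum>s\<le>Suc l. of_nat (Suc l choose s) * f s) =
     f 0 + (\<Sum>s\<le>l. of_nat (l choose Suc s) * f (Suc s)) + (\<Sum>s\<le>l. of_nat (l choose s) * f (Suc s))"
    by (simp add: sum.atMost_Suc_shift algebra_simps sum.distrib del: sum.atMost_Suc)
  also have "f 0 + (\<Sum>s\<le>l. of_nat (l choose Suc s) * f (Suc s)) = (\<Sum>s\<le>Suc l. of_nat (l choose s) * f s)"
    by (simp add: sum.atMost_Suc_shift del: sum.atMost_Suc)
  also have "\<dots> = (\<Sum>s\<le>l. of_nat (l choose s) * f s)"
    by (simp add: binomial_eq_0)
  finally show ?thesis by (simp only: distrib_left sum.distrib)
qed

lemma sum_triangle_swap:
  fixes g :: "nat \<Rightarrow> nat \<Rightarrow> 'a::comm_monoid_add"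
  shows "(\<Sum>j<N. \<Sum>s\<le>j. g j s) = (\<Sum>s<N. \<Sum>j=s..<N. g j s)"
proof (induction N)
  case (Suc N)
  have "(\<Sum>s<N. \<Sum>j=s..<Suc N. g j s) = (\<Sum>s<N. (\<Sum>j=s..<N. g j s) + g N s)"
    by (intro sum.cong) auto
  then show ?case
    using Suc by (simp add: sum.distrib lessThan_Suc_atMost[symmetric] ac_simps)
qed simp

text \<open>If \<open>A\<close> is the binomial transform of \<open>f\<close>, this is the sequence
  with binomial transform \<open>(1 - t)^l * A l\<close>. It represents the substitution of
  \<open>x (1 - t)\<close> for \<open>x\<close>.\<close>

definition power_twist :: "'a::comm_ring_1 \<Rightarrow> (nat \<Rightarrow> 'a) \<Rightarrow> nat \<Rightarrow> 'a" where
  "power_twist t f j = (\<Sum>s\<le>j. of_nat (j choose s) * (- t) ^ (j - s) * (1 - t) ^ s * f s)"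

text \<open>After \<open>(l choose j) (j choose s) = (l choose s) (l - s choose j - s)\<close> the
  sum over \<open>j\<close> is the binomial expansion of \<open>(1 + (- t))^(l - s)\<close>.\<close>

lemma binomial_transform_power_twist:
  fixes f :: "nat \<Rightarrow> 'a::comm_ring_1"
  shows "(\<Sum>j\<le>l. of_nat (l choose j) * power_twist t f j) =
    (1 - t) ^ l * (\<Sum>s\<le>l. of_nat (l choose s) * f s)"
proof -
  have inner: "(\<Sum>j=s..l. of_nat (l choose j) * (of_nat (j choose s) * (- t) ^ (j - s) * (1 - t) ^ s * f s)) =
      (1 - t) ^ l * (of_nat (l choose s) * f s)" if "s \<le> l" for s
  proof -
    have "(\<Sum>j=s..l. of_nat (l choose j) * (of_nat (j choose s) * (- t) ^ (j - s) * (1 - t) ^ s * f s)) =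
      (\<Sum>j=s..l. of_nat ((l - s) choose (j - s)) * (- t) ^ (j - s)) * (of_nat (l choose s) * (1 - t) ^ s * f s)"
      unfolding sum_distrib_right
    proof (intro sum.cong refl)
      fix j assume "j \<in> {s..l}"
      then have e: "of_nat (l choose j) * of_nat (j choose s) = (of_nat (l choose s) * of_nat ((l - s) choose (j - s)) :: 'a)"
        by (simp add: choose_mult flip: of_nat_mult)
      have "of_nat (l choose j) * (of_nat (j choose s) * (- t) ^ (j - s) * (1 - t) ^ s * f s) =
          (of_nat (l choose j) * of_nat (j choose s)) * ((- t) ^ (j - s) * (1 - t) ^ s * f s)"
        by (simp only: mult.assoc)
      also note e
      finally show "of_nat (l choose j) * (of_nat (j choose s) * (- t) ^ (j - s) * (1 - t) ^ s * f s) =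
        of_nat ((l - s) choose (j - s)) * (- t) ^ (j - s) * (of_nat (l choose s) * (1 - t) ^ s * f s)"
        by (simp only: ac_simps)
    qed
    also have "(\<Sum>j=s..l. of_nat ((l - s) choose (j - s)) * (- t) ^ (j - s)) =
        (\<Sum>i\<le>l - s. of_nat ((l - s) choose i) * (- t) ^ i)"
      using that by (intro sum.reindex_bij_witness[of _ "\<lambda>i. i + s" "\<lambda>j. j - s"]) auto
    also have "\<dots> = (1 - t) ^ (l - s)"
      using binomial_ring[of "- t" 1 "l - s"] by (simp add: add.commute)
    finally show ?thesis
      using that by (simp add: algebra_simps flip: power_add)
  qed
  have "(\<Sum>j\<le>l. of_nat (l choose j) * power_twist t f j) =
     (\<Sum>j\<le>l. \<Sum>s\<le>j. of_nat (l choose j) * (of_nat (j choose s) * (- t) ^ (j - s) * (1 - t) ^ s * f s))"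
    by (simp add: power_twist_def sum_distrib_left)
  also have "\<dots> = (\<Sum>s\<le>l. \<Sum>j=s..l. of_nat (l choose j) * (of_nat (j choose s) * (- t) ^ (j - s) * (1 - t) ^ s * f s))"
    using sum_triangle_swap[of _ "Suc l"] by (simp add: lessThan_Suc_atMost atLeastLessThanSuc_atLeastAtMost)
  also have "\<dots> = (1 - t) ^ l * (\<Sum>s\<le>l. of_nat (l choose s) * f s)"
    unfolding sum_distrib_left using inner by (intro sum.cong) auto
  finally show ?thesis .
qed

text \<open>Truncation of the series of \<open>(1 - y)^(-s-1)\<close>. Multiplying the sum for
  \<open>s + 1\<close> by \<open>1 - y\<close> telescopes by Pascal's rule to the sum for
  \<open>s\<close>, up to a boundary term containing \<open>y^m\<close>.\<close>

lemma negative_binomial_truncated: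
  fixes y :: "'a::comm_ring_1"
  shows "y ^ m dvd (1 - y) ^ Suc s * (\<Sum>i<m. of_nat ((s + i) choose s) * y ^ i) - 1"
proof (induction s)
  case 0
  have "(1 - y) * (\<Sum>i<m. y ^ i) = 1 - y ^ m"
    by (simp add: one_diff_power_eq)
  then show ?case by simp
next
  case (Suc s)
  let ?W = "\<lambda>s. \<Sum>i<m. of_nat ((s + i) choose s) * y ^ i"
  have "(1 - y) * ?W (Suc s) = ?W s - of_nat ((s + m) choose Suc s) * y ^ m"
  proof (induction m)
    case (Suc m)
    have "(1 - y) * (\<Sum>i<Suc m. of_nat ((Suc s + i) choose Suc s) * y ^ i) =
        (\<Sum>i<m. of_nat ((s + i) choose s) * y ^ i) - of_nat ((s + m) choose Suc s) * y ^ m +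
        (1 - y) * ((of_nat ((s + m) choose s) + of_nat ((s + m) choose Suc s)) * y ^ m)"
      by (simp only: sum.lessThan_Suc distrib_left Suc) simp
    also have "b - e * z + (1 - y) * ((h + e) * z) = b + h * z - (h + e) * (y * z)" for b e h z :: 'a
      by (simp add: algebra_simps)
    also have "(\<Sum>i<m. of_nat ((s + i) choose s) * y ^ i) + of_nat ((s + m) choose s) * y ^ m =
        (\<Sum>i<Suc m. of_nat ((s + i) choose s) * y ^ i)"
      by simp
    finally show ?case
      by (simp only: add_Suc_right binomial_Suc_Suc of_nat_add power_Suc)
  qed (simp add: binomial_eq_0)
  moreover have "p * (w - c * z) - 1 = (p * w - 1) - z * (c * p)" for p w c z :: 'a
    by (simp add: algebra_simps)
  ultimately have "(1 - y) ^ Suc (Suc s) * ?W (Suc s) - 1 =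
     ((1 - y) ^ Suc s * ?W s - 1) - y ^ m * (of_nat ((s + m) choose Suc s) * (1 - y) ^ Suc s)"
    by (simp only: power_Suc2[of _ "Suc s"] mult.assoc)
  then show ?case using Suc.IH by (simp only: dvd_diff dvd_triv_left)
qed

text \<open>For fixed \<open>s\<close> the sum over \<open>j\<close> is a negative binomial series
  in \<open>- t X\<close> with value \<open>((1 - t) X)^s / (1 + t X)^(s+1)\<close>. Truncating it
  after \<open>N - s\<close> terms costs a multiple of \<open>t^(N-s)\<close>, and
  \<open>f s\<close> supplies the missing \<open>t^s\<close>.\<close>

lemma power_twist_gf:
  fixes t :: "'a::comm_ring_1"
  assumes dvd: "\<And>s. t ^ s dvd f s" and Y: "Y * (1 + t * X) = (1 - t) * X"
    and inv: "(1 + t * X) * I = 1"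
  shows "t ^ N dvd (1 + t * X) * (\<Sum>j<N. X ^ j * power_twist t f j) - (\<Sum>s<N. Y ^ s * f s)"
proof -
  let ?y = "- (t * X)"
  let ?W = "\<lambda>s. \<Sum>i<N - s. of_nat ((s + i) choose s) * ?y ^ i"
  have Y': "Y = (1 - t) * X * I"
  proof -
    have "Y = Y * (1 + t * X) * I"
      using inv by (simp add: mult.assoc)
    then show ?thesis by (simp only: Y)
  qed
  have II: "I ^ s * (1 + t * X) ^ s = 1" for s
    using inv by (simp add: mult.commute flip: power_mult_distrib)
  let ?b = "\<lambda>s. (1 + t * X) * (?W s * (X ^ s * (1 - t) ^ s * f s)) - Y ^ s * f s"
  have "(\<Sum>j<N. X ^ j * power_twist t f j) =
     (\<Sum>j<N. \<Sum>s\<le>j. X ^ j * (of_nat (j choose s) * (- t) ^ (j - s) * (1 - t) ^ s * f s))"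
    by (simp add: power_twist_def sum_distrib_left)
  also have "\<dots> = (\<Sum>s<N. \<Sum>j=s..<N. X ^ j * (of_nat (j choose s) * (- t) ^ (j - s) * (1 - t) ^ s * f s))"
    by (rule sum_triangle_swap)
  also have "\<dots> = (\<Sum>s<N. ?W s * (X ^ s * (1 - t) ^ s * f s))"
  proof (intro sum.cong refl)
    fix s assume "s \<in> {..<N}"
    then have "(\<Sum>j=s..<N. X ^ j * (of_nat (j choose s) * (- t) ^ (j - s) * (1 - t) ^ s * f s)) =
      (\<Sum>i<N - s. X ^ (s + i) * (of_nat ((s + i) choose s) * (- t) ^ i * (1 - t) ^ s * f s))"
      by (intro sum.reindex_bij_witness[of _ "\<lambda>i. s + i" "\<lambda>j. j - s"]) auto
    also have "\<dots> = ?W s * (X ^ s * (1 - t) ^ s * f s)"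
      unfolding sum_distrib_right
    proof (intro sum.cong refl)
      fix i
      have "(- (t * X)) ^ i = (- t) ^ i * X ^ i"
        by (simp flip: power_mult_distrib)
      then show "X ^ (s + i) * (of_nat ((s + i) choose s) * (- t) ^ i * (1 - t) ^ s * f s) =
        of_nat ((s + i) choose s) * (- (t * X)) ^ i * (X ^ s * (1 - t) ^ s * f s)"
        by (simp add: power_add ac_simps)
    qed
    finally show "(\<Sum>j=s..<N. X ^ j * (of_nat (j choose s) * (- t) ^ (j - s) * (1 - t) ^ s * f s)) =
      ?W s * (X ^ s * (1 - t) ^ s * f s)" .
  qed
  finally have "(1 + t * X) * (\<Sum>j<N. X ^ j * power_twist t f j) - (\<Sum>s<N. Y ^ s * f s) = (\<Sum>s<N. ?b s)"
    by (simp only: sum_distrib_left sum_subtractf)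
  also have "t ^ N dvd \<dots>"
  proof (rule dvd_sum)
    fix s assume "s \<in> {..<N}"
    then have N: "t ^ N = t ^ (N - s) * t ^ s" by (simp flip: power_add)
    have "t ^ (N - s) dvd ?y ^ (N - s)"
      by (rule dvd_power_same) simp
    also have "\<dots> dvd (1 - ?y) ^ Suc s * ?W s - 1"
      by (rule negative_binomial_truncated)
    finally have "t ^ N dvd ((1 - ?y) ^ Suc s * ?W s - 1) * f s"
      unfolding N by (rule mult_dvd_mono) (rule dvd)
    moreover have "?b s = I ^ s * X ^ s * (1 - t) ^ s * (((1 - ?y) ^ Suc s * ?W s - 1) * f s)"
    proof -
      have "i * x * p * ((a * b * w - 1) * g) = i * b * (a * (w * (x * p * g))) - p * x * i * g"
        for i x p a b w g :: 'a
        by (simp add: algebra_simps)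
      from this[of "I ^ s" "X ^ s" "(1 - t) ^ s" "1 + t * X" "(1 + t * X) ^ s" "?W s" "f s"]
      show ?thesis
        by (simp only: II Y' power_mult_distrib power_Suc diff_minus_eq_add mult_1)
    qed
    ultimately show "t ^ N dvd ?b s" by (simp only: dvd_mult)
  qed
  finally show ?thesis .
qed

lemma fps_X_power_dvd_iff:
  fixes f :: "'a::comm_ring_1 fps"
  shows "fps_X ^ N dvd f \<longleftrightarrow> (\<forall>k<N. fps_nth f k = 0)"
proof
  assume "fps_X ^ N dvd f"
  then show "\<forall>k<N. fps_nth f k = 0"
    by (auto simp: fps_X_power_mult_nth elim!: dvdE)
next
  assume "\<forall>k<N. fps_nth f k = 0"
  then have "f = fps_X ^ N * fps_shift N f"
    by (intro fps_ext) (simp add: fps_X_power_mult_nth)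
  then show "fps_X ^ N dvd f" by (rule dvdI)
qed

text \<open>The t-adic topology is separated, so identities between infinite sums may be proved for
  truncations modulo every power of \<open>fps_X\<close>.\<close>

lemma fps_eqI_X_power_dvd:
  fixes f g :: "'a::comm_ring_1 fps"
  assumes "\<And>N. fps_X ^ N dvd f - g"
  shows "f = g"
proof (rule fps_ext)
  fix n
  have "fps_nth (f - g) n = 0"
    using assms[of "Suc n"] unfolding fps_X_power_dvd_iff by blast
  then show "fps_nth f n = fps_nth g n" by simp
qed

lemma sum_shift_power:
  fixes X :: "'a::comm_ring_1"
  shows "(\<Sum>s<N. X ^ Suc s * (g s + g (Suc s))) = (1 + X) * (\<Sum>s<N. X ^ s * g s) - g 0 + X ^ N * g N"
proof (induction N)
  case (Suc N)
  have "(1 + X) * a - b + p * c + X * p * (c + d) = (1 + X) * (a + p * c) - b + X * p * d" for a b c d p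
    by (simp add: algebra_simps)
  from this[of "\<Sum>s<N. X ^ s * g s" "g 0" "X ^ N" "g N" "g (Suc N)"] show ?case
    by (simp only: sum.lessThan_Suc Suc) (simp only: power_Suc)
qed simp

lemma dvd_power_twist:
  assumes "\<And>s. t ^ s dvd f s"
  shows "t ^ j dvd power_twist t f j"
  unfolding power_twist_def
proof (rule dvd_sum)
  fix s assume "s \<in> {..j}"
  then have "t ^ j = t ^ (j - s) * t ^ s" by (simp flip: power_add)
  also have "\<dots> dvd (- t) ^ (j - s) * f s"
    by (intro mult_dvd_mono dvd_power_same assms) simp
  also have "\<dots> dvd of_nat (j choose s) * (- t) ^ (j - s) * (1 - t) ^ s * f s"
    by (rule dvdI[of _ _ "of_nat (j choose s) * (1 - t) ^ s"]) (simp add: ac_simps)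
  finally show "t ^ j dvd of_nat (j choose s) * (- t) ^ (j - s) * (1 - t) ^ s * f s" .
qed

text \<open>
  The sum of \<open>A l * x ^ l\<close> over \<open>l\<close> is that of \<open>f s * x ^ s / (1 - x) ^ (s + 1)\<close> over \<open>s\<close>. The latter
  converges \<open>t\<close>-adically whenever \<open>1 - x\<close> is invertible, which is how \<open>x\<close> can be specialized to
  power series that are not small. Below, \<open>X = x / (1 - x)\<close> and \<open>Y\<close> is the same for \<open>x (1 - t)\<close>.
\<close>

lemma binomial_transform_functional_equation:
  fixes c d e X Y I t :: "'a::comm_ring_1"
  assumes dvd: "\<And>s. t ^ s dvd f s" and Y: "Y * (1 + t * X) = (1 - t) * X"
    and inv: "(1 + t * X) * I = 1"
    and A: "\<And>l. A l = (\<Sum>s\<le>l. of_nat (l choose s) * f s)"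
    and rec: "\<And>l. (c * (1 - t) ^ Suc l - d) * A (Suc l) = ((1 - t) ^ Suc l - e) * A l"
  shows "t ^ N dvd (c * (1 + X) - (1 - t) * X) * (I * (\<Sum>s<N. Y ^ s * f s))
       - (d * (1 + X) - e * X) * (\<Sum>s<N. X ^ s * f s) - (c - d) * A 0"
proof -
  let ?M = "power_twist t f"
  let ?P = "\<Sum>s<N. X ^ s * f s" and ?Q = "\<Sum>s<N. X ^ s * ?M s" and ?P' = "\<Sum>s<N. Y ^ s * f s"
  have M: "(\<Sum>s\<le>l. of_nat (l choose s) * ?M s) = (1 - t) ^ l * A l" for l
    by (simp add: A binomial_transform_power_twist)
  \<comment> \<open>By \<open>rec\<close> both sides have the same binomial transform, so the
    recurrence in \<open>l\<close> becomes a relation between neighbouring values of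
    \<open>f\<close> and \<open>?M\<close>.\<close>
  have coeffs: "c * (?M s + ?M (Suc s)) - d * (f s + f (Suc s)) = (1 - t) * ?M s - e * f s" for s
  proof (rule binomial_transform_inject)
    fix l
    have "(\<Sum>s\<le>l. of_nat (l choose s) * (c * (?M s + ?M (Suc s)) - d * (f s + f (Suc s)))) =
      c * (\<Sum>s\<le>l. of_nat (l choose s) * (?M s + ?M (Suc s))) - d * (\<Sum>s\<le>l. of_nat (l choose s) * (f s + f (Suc s)))"
      by (simp add: sum_distrib_left sum_subtractf right_diff_distrib mult.left_commute)
    also have "\<dots> = (c * (1 - t) ^ Suc l - d) * A (Suc l)"
      by (simp only: binomial_transform_shift M A[symmetric]) (simp add: algebra_simps)
    also have "\<dots> = (1 - t) * (\<Sum>s\<le>l. of_nat (l choose s) * ?M s) - e * (\<Sum>s\<le>l. of_nat (l choose s) * f s)"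
      by (simp only: rec M A[symmetric]) (simp add: algebra_simps)
    also have "\<dots> = (\<Sum>s\<le>l. of_nat (l choose s) * ((1 - t) * ?M s - e * f s))"
      by (simp add: sum_distrib_left sum_subtractf right_diff_distrib mult.left_commute)
    finally show "(\<Sum>s\<le>l. of_nat (l choose s) * (c * (?M s + ?M (Suc s)) - d * (f s + f (Suc s)))) =
      (\<Sum>s\<le>l. of_nat (l choose s) * ((1 - t) * ?M s - e * f s))" .
  qed
  have "c * (\<Sum>s<N. X ^ Suc s * (?M s + ?M (Suc s))) - d * (\<Sum>s<N. X ^ Suc s * (f s + f (Suc s))) =
      (\<Sum>s<N. X ^ Suc s * (c * (?M s + ?M (Suc s)) - d * (f s + f (Suc s))))"
    by (simp add: sum_distrib_left sum_subtractf right_diff_distrib mult.left_commute)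
  also have "\<dots> = (1 - t) * X * ?Q - e * X * ?P"
    unfolding coeffs
    by (simp add: sum_distrib_left sum_subtractf right_diff_distrib mult.left_commute mult.assoc)
  finally have main: "c * ((1 + X) * ?Q - ?M 0 + X ^ N * ?M N) - d * ((1 + X) * ?P - f 0 + X ^ N * f N) =
      (1 - t) * X * ?Q - e * X * ?P"
    by (simp only: sum_shift_power)
  have zero: "?M 0 = f 0" "A 0 = f 0"
    by (simp_all add: power_twist_def A)
  have Q: "?Q = I * ((1 + t * X) * ?Q)"
    using inv by (simp add: mult.commute mult.left_commute flip: mult.assoc)
  \<comment> \<open>What remains are two boundary terms at \<open>N\<close> and the error of
    \<open>power_twist_gf\<close>, each divisible by \<open>t^N\<close>.\<close>
  have "(c * (1 + X) - (1 - t) * X) * (I * ?P') - (d * (1 + X) - e * X) * ?P - (c - d) * A 0 =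
      d * X ^ N * f N - c * X ^ N * ?M N - (c * (1 + X) - (1 - t) * X) * I * ((1 + t * X) * ?Q - ?P')"
  proof -
    have "(c * (1 + X) - (1 - t) * X) * (I * ?P') =
       (c * (1 + X) - (1 - t) * X) * ?Q - (c * (1 + X) - (1 - t) * X) * I * ((1 + t * X) * ?Q - ?P')"
      by (simp only: right_diff_distrib mult.assoc Q[symmetric]) simp
    moreover have "(c * (1 + X) - (1 - t) * X) * ?Q - (d * (1 + X) - e * X) * ?P - (c - d) * A 0 =
       d * X ^ N * f N - c * X ^ N * ?M N"
    proof -
      have "(c * (1 + X) - (1 - t) * X) * q - (d * (1 + X) - e * X) * p - (c - d) * a - (d * y * m - c * y * n) =
         c * ((1 + X) * q - a + y * n) - d * ((1 + X) * p - a + y * m) - ((1 - t) * X * q - e * X * p)"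
        for a p q m n y
        by (simp add: algebra_simps)
      from this[of ?Q ?P "f 0" "X ^ N" "f N" "?M N"] show ?thesis
        using main unfolding zero by simp
    qed
    moreover have "a - p - q = s - r" if "a = b - r" "b - p - q = s" for a b p q r s :: 'a
      unfolding that(2)[symmetric] that(1) by simp
    ultimately show ?thesis by blast
  qed
  also have "t ^ N dvd \<dots>"
    by (intro dvd_diff dvd_mult dvd dvd_power_twist power_twist_gf[OF dvd Y inv])
  finally show ?thesis .
qed

section \<open>Standardization of words\<close>

definition words :: "nat \<Rightarrow> nat \<Rightarrow> nat list set" where
  "words n l = {xs. set xs \<subseteq> {..<l} \<and> length xs = n}"

lemma finite_words [simp]: "finite (words n l)"
  by (simp add: words_def finite_lists_length_eq)

lemma words_iff: "xs \<in> words n l \<longleftrightarrow> length xs = n \<and> (\<forall>i<n. xs ! i < l)"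
  by (auto simp: words_def set_conv_nth)

definition word_des :: "nat list \<Rightarrow> nat" where
  "word_des xs = card {i. Suc i < length xs \<and> xs ! i > xs ! Suc i}"

text \<open>Standardization ranks equal letters from left to right, so a tie counts as an increase.
  This is why the inequality is weak here but strict in \<open>word_rmax\<close> and
  \<open>word_des\<close>.\<close>

definition word_lmax :: "nat list \<Rightarrow> nat" where
  "word_lmax xs = card {i. i < length xs \<and> (\<forall>j<i. xs ! j \<le> xs ! i)}"

definition word_rmax :: "nat list \<Rightarrow> nat" where
  "word_rmax xs = card {i. i < length xs \<and> (\<forall>j<length xs. i < j \<longrightarrow> xs ! j < xs ! i)}"

text \<open>With \<open>D\<close> the inverse descents of a permutation, these are the sorted
  contents of the words that standardize to it.\<close>

definition mono_words :: "nat \<Rightarrow> (nat \<Rightarrow> bool) \<Rightarrow> nat \<Rightarrow> nat list set" where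
  "mono_words n D l = {xs \<in> words n l. \<forall>i. Suc i < n \<longrightarrow>
     xs ! i \<le> xs ! Suc i \<and> (D i \<longrightarrow> xs ! i < xs ! Suc i)}"

lemma finite_mono_words [simp]: "finite (mono_words n D l)"
  by (simp add: mono_words_def)

lemma mono_words_le:
  assumes "xs \<in> mono_words n D l" "i \<le> j" "j < n"
  shows "xs ! i \<le> xs ! j"
  using assms by (auto simp: mono_words_def words_iff sorted_iff_nth_Suc intro!: sorted_nth_mono)

text \<open>Split by whether the last letter is \<open>l\<close>. If it is, \<open>D (n - 1)\<close>
  concerns the final step and decides whether \<open>l\<close> may still occur in the shortened
  word.\<close>

lemma mono_words_Suc:
  assumes "n > 0"
  shows "mono_words (Suc n) D (Suc l) =
    mono_words (Suc n) D l \<union> (\<lambda>xs. xs @ [l]) ` mono_words n D (if D (n - 1) then l else Suc l)"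
    (is "?L = ?A \<union> ?B")
proof (intro equalityI subsetI)
  fix xs assume xs: "xs \<in> ?L"
  then have len: "length xs = Suc n" and lt: "\<And>i. i < Suc n \<Longrightarrow> xs ! i < Suc l"
    and adj: "\<And>i. Suc i < Suc n \<Longrightarrow> xs ! i \<le> xs ! Suc i \<and> (D i \<longrightarrow> xs ! i < xs ! Suc i)"
    by (auto simp: mono_words_def words_iff)
  show "xs \<in> ?A \<union> ?B"
  proof (cases "xs ! n = l")
    case False
    then have "xs ! i < l" if "i < Suc n" for i
      using mono_words_le[OF xs, of i n] lt[of n] that by simp
    then show ?thesis using adj len by (auto simp: mono_words_def words_iff)
  next
    case True
    obtain ys where ys: "xs = ys @ [l]" "length ys = n"
      using len True by (cases xs rule: rev_cases) auto
    have nth: "ys ! i = xs ! i" if "i < n" for i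
      using that ys by (simp add: nth_append)
    have "ys ! i < l" if "i < n" "D (n - 1)" for i
    proof -
      have "i \<le> n - 1" "n - 1 < Suc n" "Suc (n - 1) = n"
        using that by auto
      then show ?thesis
        using mono_words_le[OF xs, of i "n - 1"] adj[of "n - 1"] that True by (simp add: nth)
    qed
    then have "ys \<in> mono_words n D (if D (n - 1) then l else Suc l)"
      using adj lt ys by (auto simp: mono_words_def words_iff nth)
    then show ?thesis using ys by blast
  qed
next
  fix xs assume "xs \<in> ?A \<union> ?B"
  then show "xs \<in> ?L"
  proof
    assume "xs \<in> ?A"
    then show ?thesis by (auto simp: mono_words_def words_iff less_Suc_eq)
  next
    assume "xs \<in> ?B"
    then obtain ys where ys: "xs = ys @ [l]" "ys \<in> mono_words n D (if D (n - 1) then l else Suc l)"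
      by blast
    then have len: "length ys = n" and lt: "\<And>i. i < n \<Longrightarrow> ys ! i < (if D (n - 1) then l else Suc l)"
      and adj: "\<And>i. Suc i < n \<Longrightarrow> ys ! i \<le> ys ! Suc i \<and> (D i \<longrightarrow> ys ! i < ys ! Suc i)"
      by (auto simp: mono_words_def words_iff)
    have "ys ! i < Suc l" if "i < n" for i
      using lt[OF that] by (simp split: if_splits)
    moreover have "ys ! i < l" if "Suc i = n" "D i" for i
      using lt[of i] that by auto
    ultimately show ?thesis using len adj
      by (auto simp: mono_words_def words_iff nth_append ys(1) less_Suc_eq_le)
  qed
qed

text \<open>Lowering each letter by the number of forced ascents before it would leave weakly
  increasing words over a smaller alphabet. The proof is by induction on \<open>n\<close> and then
  \<open>l\<close>, where \<open>mono_words_Suc\<close> becomes Pascal's rule.\<close>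

lemma card_mono_words:
  assumes "n > 0"
  shows "card (mono_words n D l) = (l + n - 1 - card {i. Suc i < n \<and> D i}) choose n"
  using assms
proof (induction n arbitrary: l rule: nat_induct_non_zero)
  case 1
  have "mono_words 1 D l = (\<lambda>x. [x]) ` {..<l}"
    by (auto simp: mono_words_def words_def length_Suc_conv)
  then show ?case by (simp add: card_image inj_on_def)
next
  case (Suc n)
  define d where "d = card {i. Suc i < n \<and> D i}"
  \<comment> \<open>This bound makes the natural number subtractions in the binomial coefficients
    exact.\<close>
  have d: "d \<le> n - 1"
    unfolding d_def by (rule order.trans[OF card_mono[of "{..<n - 1}"]]) auto
  have eq: "{i. Suc i < Suc n \<and> D i} = (if D (n - 1) then insert (n - 1) {i. Suc i < n \<and> D i} else {i. Suc i < n \<and> D i})"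
  proof -
    have iff: "Suc i < Suc n \<longleftrightarrow> Suc i < n \<or> i = n - 1" for i
      using \<open>0 < n\<close> by linarith
    show ?thesis unfolding iff by auto
  qed
  have "finite {i. Suc i < n \<and> D i}" "n - 1 \<notin> {i. Suc i < n \<and> D i}"
    by (auto intro: finite_subset[of _ "{..<n}"])
  then have D: "card {i. Suc i < Suc n \<and> D i} = (if D (n - 1) then Suc d else d)"
    unfolding eq d_def by (cases "D (n - 1)") simp_all
  show ?case
  proof (induction l)
    case 0
    have "mono_words (Suc n) D 0 = {}"
      by (auto simp: mono_words_def words_iff)
    then show ?case by simp
  next
    case (Suc l)
    let ?B = "mono_words n D (if D (n - 1) then l else Suc l)"
    have "mono_words (Suc n) D l \<inter> (\<lambda>xs. xs @ [l]) ` ?B = {}"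
      by (auto simp: mono_words_def words_def)
    then have "card (mono_words (Suc n) D (Suc l)) = card (mono_words (Suc n) D l) + card ?B"
      using \<open>0 < n\<close> by (simp add: mono_words_Suc card_Un_disjoint card_image inj_on_def)
    also have "card ?B = ((if D (n - 1) then l else Suc l) + n - 1 - d) choose n"
      using \<open>\<And>l. card (mono_words n D l) = _ l\<close> by (simp add: d_def)
    finally have rec: "card (mono_words (Suc n) D (Suc l)) = (l + Suc n - 1 - (if D (n - 1) then Suc d else d) choose Suc n)
        + ((if D (n - 1) then l else Suc l) + n - 1 - d choose n)"
      unfolding Suc.IH D .
    have "l + Suc n - 1 - Suc d = l + n - 1 - d" "Suc l + Suc n - 1 - Suc d = Suc (l + n - 1 - d)"
      "l + Suc n - 1 - d = Suc l + n - 1 - d" "Suc l + Suc n - 1 - d = Suc (Suc l + n - 1 - d)"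
      using d \<open>0 < n\<close> by linarith+
    then show ?case
      unfolding rec D by (cases "D (n - 1)") (simp_all only: if_True if_False binomial_Suc_Suc add.commute)
  qed
qed

text \<open>The positions with value at most \<open>p i\<close> map bijectively onto
  \<open>{1..p i}\<close>. Hence a permutation is determined by the relative order of its
  values.\<close>

lemma permutes_eq_card_le:
  assumes "p permutes {1..n}" "i \<in> {1..n}"
  shows "p i = card {j \<in> {1..n}. p j \<le> p i}"
proof -
  have "p ` {j \<in> {1..n}. p j \<le> p i} = {1..p i}"
  proof (intro equalityI subsetI)
    fix y assume "y \<in> {1..p i}"
    moreover have "p i \<in> {1..n}" using assms by (simp only: permutes_in_image)
    ultimately have "y \<in> p ` {1..n}" using assms(1) by (simp add: permutes_image)
    then show "y \<in> p ` {j \<in> {1..n}. p j \<le> p i}"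
      using \<open>y \<in> {1..p i}\<close> by auto
  next
    fix y assume "y \<in> p ` {j \<in> {1..n}. p j \<le> p i}"
    then obtain j where "j \<in> {1..n}" "p j \<le> p i" "y = p j"
      by blast
    then show "y \<in> {1..p i}"
      using permutes_in_image[OF assms(1), of j] by simp
  qed
  moreover have "inj_on p {j \<in> {1..n}. p j \<le> p i}"
    using assms(1) permutes_inj_on by blast
  ultimately show ?thesis
    using card_image[of p "{j \<in> {1..n}. p j \<le> p i}"] by simp
qed

text \<open>\<open>ys\<close> holds the letters in sorted order and \<open>p (Suc i)\<close> is the
  rank of the letter at position \<open>i\<close>. The shifts by one convert between 1-based
  permutations and 0-based lists.\<close>

definition destandardize :: "nat \<Rightarrow> (nat \<Rightarrow> nat) \<Rightarrow> nat list \<Rightarrow> nat list" where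
  "destandardize n p ys = map (\<lambda>i. ys ! (p (Suc i) - 1)) [0..<n]"

text \<open>At an inverse descent the next larger rank stands further left. As equal letters are
  ranked from left to right, the two letters must then differ.\<close>

abbreviation compatible :: "nat \<Rightarrow> (nat \<Rightarrow> nat) \<Rightarrow> nat \<Rightarrow> nat list set" where
  "compatible n p \<equiv> mono_words n (\<lambda>i. inv p (Suc i) > inv p (Suc (Suc i)))"

text \<open>Since \<open>ys\<close> is sorted, it is constant between \<open>i\<close> and
  \<open>j\<close>, so no step in between is an inverse descent.\<close>

lemma compatible_eq_less:
  assumes p: "p permutes {1..n}" and ys: "ys \<in> compatible n p l"
    and "i < j" "j < n" "ys ! i = ys ! j"
  shows "inv p (Suc i) < inv p (Suc j)"
proof -
  have step: "inv p (Suc k) < inv p (Suc (Suc k))" if "Suc k < n" "ys ! k = ys ! Suc k" for k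
  proof -
    have "\<not> inv p (Suc k) > inv p (Suc (Suc k))"
      using ys that by (auto simp: mono_words_def)
    moreover have "inv p (Suc k) \<noteq> inv p (Suc (Suc k))"
      by (simp add: inj_eq[OF permutes_inj[OF permutes_inv[OF p]]])
    ultimately show ?thesis by simp
  qed
  have "inv p (Suc i) < inv p (Suc (i + Suc d))" if "i + Suc d < n" "ys ! i = ys ! (i + Suc d)" for d
    using that
  proof (induction d)
    case 0
    then show ?case using step[of i] by simp
  next
    case (Suc d)
    have "ys ! i \<le> ys ! (i + Suc d)" "ys ! (i + Suc d) \<le> ys ! (i + Suc (Suc d))"
      using Suc.prems(1) by (simp_all add: mono_words_le[OF ys])
    with Suc.prems(2) have "ys ! i = ys ! (i + Suc d)" "ys ! (i + Suc d) = ys ! (i + Suc (Suc d))"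
      by linarith+
    then show ?case using Suc.IH step[of "i + Suc d"] Suc.prems by simp
  qed
  from this[of "j - Suc i"] assms(3-5) show ?thesis by simp
qed

lemma nth_destandardize: "i < n \<Longrightarrow> destandardize n p ys ! i = ys ! (p (Suc i) - 1)"
  by (simp add: destandardize_def)

text \<open>This identifies \<open>p\<close> as the standardization of \<open>xs\<close>. One
  implication suffices, because both sides are strict linear orders on the positions.\<close>

lemma destandardize_order:
  assumes p: "p permutes {1..n}" and ys: "ys \<in> compatible n p l" and "i < n" "j < n"
  defines "xs \<equiv> destandardize n p ys"
  shows "p (Suc i) < p (Suc j) \<longleftrightarrow> xs ! i < xs ! j \<or> xs ! i = xs ! j \<and> i < j"
proof -
  have imp: "xs ! i < xs ! j \<or> xs ! i = xs ! j \<and> i < j"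
    if "i < n" "j < n" "p (Suc i) < p (Suc j)" for i j
  proof -
    have "p (Suc i) \<in> {1..n}" "p (Suc j) \<in> {1..n}"
      using that permutes_in_image[OF p, of "Suc i"] permutes_in_image[OF p, of "Suc j"] by simp_all
    then have lt: "p (Suc i) - 1 < p (Suc j) - 1" "p (Suc j) - 1 < n"
        "Suc (p (Suc i) - 1) = p (Suc i)" "Suc (p (Suc j) - 1) = p (Suc j)"
      using that by auto
    have "xs ! i \<le> xs ! j"
      using mono_words_le[OF ys] lt that by (simp add: xs_def nth_destandardize)
    moreover have "i < j" if "xs ! i = xs ! j"
      using compatible_eq_less[OF p ys lt(1,2)] that lt \<open>i < n\<close> \<open>j < n\<close>
      by (simp add: xs_def nth_destandardize permutes_inverses[OF p])
    ultimately show ?thesis by linarith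
  qed
  show ?thesis
  proof
    assume "xs ! i < xs ! j \<or> xs ! i = xs ! j \<and> i < j"
    then have "\<not> p (Suc j) < p (Suc i)" "i \<noteq> j \<or> xs ! i < xs ! j"
      using imp[of j i] assms(3,4) by auto
    moreover have "p (Suc i) \<noteq> p (Suc j)" if "i \<noteq> j"
      using that by (simp add: inj_eq[OF permutes_inj[OF p]])
    ultimately show "p (Suc i) < p (Suc j)"
      by (cases "i = j") auto
  qed (use imp assms in blast)
qed

text \<open>The standardization of a word: the rank of a position in the order by letter, then by
  position. The value \<open>i\<close> outside \<open>{1..n}\<close> is what \<open>permutes\<close>
  demands.\<close>

definition standard_rank :: "nat \<Rightarrow> nat list \<Rightarrow> nat \<Rightarrow> nat" where
  "standard_rank n xs i = (if i \<in> {1..n} then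
     card {j. j < n \<and> (xs ! j < xs ! (i - 1) \<or> xs ! j = xs ! (i - 1) \<and> j \<le> i - 1)} else i)"

lemma standard_rank_less:
  assumes "i < n" "j < n" "xs ! i < xs ! j \<or> xs ! i = xs ! j \<and> i < j"
  shows "standard_rank n xs (Suc i) < standard_rank n xs (Suc j)"
proof -
  let ?S = "\<lambda>i. {j. j < n \<and> (xs ! j < xs ! i \<or> xs ! j = xs ! i \<and> j \<le> i)}"
  have "j \<in> ?S j" "j \<notin> ?S i" "?S i \<subseteq> ?S j"
    using assms by auto
  then have "?S i \<subset> ?S j" by blast
  then have "card (?S i) < card (?S j)"
    by (intro psubset_card_mono) auto
  then show ?thesis using assms by (simp add: standard_rank_def)
qed

lemma standard_rank_less_iff:
  assumes "i < n" "j < n"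
  shows "standard_rank n xs (Suc i) < standard_rank n xs (Suc j) \<longleftrightarrow>
    xs ! i < xs ! j \<or> xs ! i = xs ! j \<and> i < j"
proof (cases "xs ! i < xs ! j \<or> xs ! i = xs ! j \<and> i < j")
  case False
  then have "i = j \<or> standard_rank n xs (Suc j) < standard_rank n xs (Suc i)"
    using standard_rank_less[OF assms(2,1), of xs] by linarith
  with False show ?thesis by auto
qed (simp add: standard_rank_less assms)

lemma standard_rank_permutes: "standard_rank n xs permutes {1..n}"
proof (rule bij_imp_permutes)
  have inj: "inj_on (standard_rank n xs) {1..n}"
  proof (rule linorder_inj_onI)
    fix i j assume "i < j" "i \<in> {1..n}" "j \<in> {1..n}"
    then obtain a b where ab: "i = Suc a" "j = Suc b" "a < n" "b < n" "a < b"
      by (cases i; cases j) auto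
    then have "standard_rank n xs i < standard_rank n xs j \<or> standard_rank n xs j < standard_rank n xs i"
      by (simp add: standard_rank_less_iff) linarith
    then show "standard_rank n xs i \<noteq> standard_rank n xs j" by linarith
  qed auto
  have "standard_rank n xs i \<in> {1..n}" if "i \<in> {1..n}" for i
  proof -
    let ?S = "{j. j < n \<and> (xs ! j < xs ! (i - 1) \<or> xs ! j = xs ! (i - 1) \<and> j \<le> i - 1)}"
    have "i - 1 \<in> ?S" using that by auto
    moreover have "?S \<subseteq> {..<n}" by auto
    ultimately have "0 < card ?S" "card ?S \<le> n"
      using finite_subset card_gt_0_iff card_mono[of "{..<n}" ?S] by fastforce+
    then show ?thesis using that by (simp add: standard_rank_def)
  qed
  then have "standard_rank n xs ` {1..n} = {1..n}"
    by (intro endo_inj_surj inj) auto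
  with inj show "bij_betw (standard_rank n xs) {1..n} {1..n}"
    by (simp add: bij_betw_def)
qed (auto simp: standard_rank_def)

lemma permutes_eqI_less:
  assumes "p permutes {1..n}" "q permutes {1..n}"
    and "\<And>i j. i < n \<Longrightarrow> j < n \<Longrightarrow> p (Suc i) < p (Suc j) \<longleftrightarrow> q (Suc i) < q (Suc j)"
  shows "p = q"
proof
  fix i
  show "p i = q i"
  proof (cases "i \<in> {1..n}")
    case True
    have "p j \<le> p i \<longleftrightarrow> q j \<le> q i" if "j \<in> {1..n}" for j
      using assms(3)[of "i - 1" "j - 1"] True that by (auto simp flip: not_less)
    then have "{j \<in> {1..n}. p j \<le> p i} = {j \<in> {1..n}. q j \<le> q i}"
      by blast
    then show ?thesis
      using permutes_eq_card_le[OF assms(1) True] permutes_eq_card_le[OF assms(2) True] by simp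
  qed (use assms permutes_not_in in metis)
qed

text \<open>Injectivity: the word determines the relative order of \<open>p\<close>, hence
  \<open>p\<close>, and then \<open>ys\<close> by undoing the rearrangement. Surjectivity: take the
  standardization and the sorted word.\<close>

lemma bij_betw_destandardize:
  "bij_betw (\<lambda>(p, ys). destandardize n p ys)
     (SIGMA p:{p. p permutes {1..n}}. compatible n p l) (words n l)"
  unfolding bij_betw_def
proof (intro conjI equalityI subsetI)
  have "p = q \<and> ys = zs"
    if p: "p permutes {1..n}" and q: "q permutes {1..n}"
      and ys: "ys \<in> compatible n p l" and zs: "zs \<in> compatible n q l"
      and eq: "destandardize n p ys = destandardize n q zs" for p q ys zs
  proof
    show pq: "p = q"
    proof (rule permutes_eqI_less[OF p q])
      fix i j assume "i < n" "j < n"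
      then show "p (Suc i) < p (Suc j) \<longleftrightarrow> q (Suc i) < q (Suc j)"
        using destandardize_order[OF p ys, of i j] destandardize_order[OF q zs, of i j] eq by simp
    qed
    show "ys = zs"
    proof (rule nth_equalityI)
      show "length ys = length zs"
        using ys zs by (auto simp: mono_words_def words_iff)
      fix k assume "k < length ys"
      then have k: "k < n" using ys by (auto simp: mono_words_def words_iff)
      then have "inv p (Suc k) \<in> {1..n}"
        using permutes_in_image[OF permutes_inv[OF p], of "Suc k"] by auto
      then obtain i where i: "inv p (Suc k) = Suc i" "i < n"
        by (cases "inv p (Suc k)") auto
      then have "p (Suc i) = Suc k"
        using permutes_inverses(1)[OF p] by metis
      then show "ys ! k = zs ! k"
        using nth_destandardize[OF i(2), of p ys] nth_destandardize[OF i(2), of q zs] eq pq by simp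
    qed
  qed
  then show "inj_on (\<lambda>(p, ys). destandardize n p ys) (SIGMA p:{p. p permutes {1..n}}. compatible n p l)"
    by (auto simp: inj_on_def)
next
  fix xs assume "xs \<in> (\<lambda>(p, ys). destandardize n p ys) ` (SIGMA p:{p. p permutes {1..n}}. compatible n p l)"
  then obtain p ys where p: "p permutes {1..n}" and ys: "ys \<in> compatible n p l"
    and xs: "xs = destandardize n p ys" by auto
  have "ys ! (p (Suc i) - 1) < l" if "i < n" for i
  proof -
    have "p (Suc i) - 1 < n"
      using permutes_in_image[OF p, of "Suc i"] that by auto
    then show ?thesis using ys by (auto simp: mono_words_def words_iff)
  qed
  then show "xs \<in> words n l"
    by (simp add: xs words_iff destandardize_def)
next
  fix xs assume xs: "xs \<in> words n l"
  define p where "p = standard_rank n xs"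
  \<comment> \<open>\<open>inv p (Suc k)\<close> is the position of rank \<open>k + 1\<close>, so
    this is \<open>xs\<close> sorted.\<close>
  define ys where "ys = map (\<lambda>k. xs ! (inv p (Suc k) - 1)) [0..<n]"
  have p: "p permutes {1..n}"
    unfolding p_def by (rule standard_rank_permutes)
  have pre: "\<exists>i<n. inv p (Suc k) = Suc i \<and> p (Suc i) = Suc k" if "k < n" for k
  proof -
    have "inv p (Suc k) \<in> {1..n}"
      using permutes_in_image[OF permutes_inv[OF p], of "Suc k"] that by auto
    then obtain i where "inv p (Suc k) = Suc i" "i < n"
      by (cases "inv p (Suc k)") auto
    then show ?thesis
      using permutes_inverses(1)[OF p, of "Suc k"] by auto
  qed
  have lt: "xs ! i < xs ! j \<or> xs ! i = xs ! j \<and> i < j \<longleftrightarrow> p (Suc i) < p (Suc j)" if "i < n" "j < n" for i j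
    using standard_rank_less_iff[OF that, of xs] by (simp add: p_def)
  have "ys \<in> compatible n p l"
    unfolding mono_words_def
  proof (intro CollectI conjI allI impI)
    show "ys \<in> words n l"
      unfolding words_iff
    proof (intro conjI allI impI)
      fix k assume "k < n"
      with pre[OF this] show "ys ! k < l"
        using xs by (auto simp: ys_def words_iff)
    qed (simp add: ys_def)
  next
    fix k assume k: "Suc k < n"
    obtain i where i: "i < n" "inv p (Suc k) = Suc i" "p (Suc i) = Suc k"
      using pre[of k] k by auto
    obtain j where j: "j < n" "inv p (Suc (Suc k)) = Suc j" "p (Suc j) = Suc (Suc k)"
      using pre[of "Suc k"] k by auto
    have ij: "xs ! i < xs ! j \<or> xs ! i = xs ! j \<and> i < j"
      using lt[of i j] i j by simp
    have nth: "ys ! k = xs ! i" "ys ! Suc k = xs ! j"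
      using k i j by (simp_all add: ys_def)
    show "ys ! k \<le> ys ! Suc k"
      using ij by (auto simp: nth)
    assume "inv p (Suc (Suc k)) < inv p (Suc k)"
    then show "ys ! k < ys ! Suc k"
      using ij by (auto simp: nth i j)
  qed
  moreover have "destandardize n p ys = xs"
  proof (rule nth_equalityI)
    show "length (destandardize n p ys) = length xs"
      using xs by (simp add: destandardize_def words_iff)
    fix i assume "i < length (destandardize n p ys)"
    then have i: "i < n" by (simp add: destandardize_def)
    then have "p (Suc i) \<in> {1..n}"
      using permutes_in_image[OF p, of "Suc i"] by auto
    then show "destandardize n p ys ! i = xs ! i"
      using i by (auto simp: nth_destandardize ys_def permutes_inverses[OF p])
  qed
  ultimately show "xs \<in> (\<lambda>(p, ys). destandardize n p ys) ` (SIGMA p:{p. p permutes {1..n}}. compatible n p l)"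
    using p by force
qed

section \<open>Statistics of a word and of its standardization\<close>

lemma card_Suc_image:
  assumes "\<And>i. P i \<longleftrightarrow> (\<exists>j. i = Suc j \<and> Q j)"
  shows "card {i. P i} = card {j. Q j}"
proof -
  have "{i. P i} = Suc ` {j. Q j}" using assms by auto
  then show ?thesis by (simp add: card_image)
qed

lemma ball_atLeastAtMost_1: "(\<forall>j\<in>{1..n}. P j) \<longleftrightarrow> (\<forall>j<n. P (Suc j))"
  unfolding image_Suc_lessThan[symmetric] by auto

context
  fixes n l :: nat and p :: "nat \<Rightarrow> nat" and ys xs :: "nat list"
  assumes p: "p permutes {1..n}" and ys: "ys \<in> compatible n p l"
    and xs: "xs = destandardize n p ys"
begin

lemma length_destandardize: "length xs = n"
  by (simp add: xs destandardize_def)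

lemmas destandardize_less_iff = destandardize_order[OF p ys, folded xs]

lemma word_des_destandardize: "word_des xs = des n p"
  unfolding word_des_def des_def length_destandardize
proof (rule card_Suc_image[symmetric])
  fix i
  show "i \<in> {1..<n} \<and> p (Suc i) < p i \<longleftrightarrow> (\<exists>j. i = Suc j \<and> Suc j < n \<and> xs ! Suc j < xs ! j)"
    using destandardize_less_iff[of "Suc (i - 1)" "i - 1"] by (cases i) auto
qed

lemma word_lmax_destandardize: "word_lmax xs = lmax n p"
proof -
  have "{p i |i. i \<in> {1..n} \<and> (\<forall>j\<in>{1..n}. j < i \<longrightarrow> p j < p i)} =
      p ` {i. i \<in> {1..n} \<and> (\<forall>j\<in>{1..n}. j < i \<longrightarrow> p j < p i)}"
    by auto
  then have "lmax n p = card {i. i \<in> {1..n} \<and> (\<forall>j\<in>{1..n}. j < i \<longrightarrow> p j < p i)}"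
    unfolding lmax_def using card_image[OF permutes_inj_on[OF p]] by simp
  also have "\<dots> = word_lmax xs"
    unfolding word_lmax_def length_destandardize
  proof (rule card_Suc_image)
    fix i
    have "(\<forall>j\<in>{1..n}. j < Suc i \<longrightarrow> p j < p (Suc i)) \<longleftrightarrow> (\<forall>j<i. xs ! j \<le> xs ! i)" if "i < n" for i
    proof -
      have "(\<forall>j\<in>{1..n}. j < Suc i \<longrightarrow> p j < p (Suc i)) \<longleftrightarrow> (\<forall>j<i. p (Suc j) < p (Suc i))"
        unfolding ball_atLeastAtMost_1 using that by auto
      also have "\<dots> \<longleftrightarrow> (\<forall>j<i. xs ! j \<le> xs ! i)"
        using destandardize_less_iff[of _ i] that by (auto simp: le_less)
      finally show ?thesis .
    qed
    then show "i \<in> {1..n} \<and> (\<forall>j\<in>{1..n}. j < i \<longrightarrow> p j < p i) \<longleftrightarrow>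
      (\<exists>j. i = Suc j \<and> j < n \<and> (\<forall>k<j. xs ! k \<le> xs ! j))"
      by (cases i) auto
  qed
  finally show ?thesis by simp
qed

lemma word_rmax_destandardize: "word_rmax xs = rmax n p"
proof -
  have "{p i |i. i \<in> {1..n} \<and> (\<forall>j\<in>{1..n}. i < j \<longrightarrow> p j < p i)} =
      p ` {i. i \<in> {1..n} \<and> (\<forall>j\<in>{1..n}. i < j \<longrightarrow> p j < p i)}"
    by auto
  then have "rmax n p = card {i. i \<in> {1..n} \<and> (\<forall>j\<in>{1..n}. i < j \<longrightarrow> p j < p i)}"
    unfolding rmax_def using card_image[OF permutes_inj_on[OF p]] by simp
  also have "\<dots> = word_rmax xs"
    unfolding word_rmax_def length_destandardize
  proof (rule card_Suc_image)
    fix i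
    have "(\<forall>j\<in>{1..n}. Suc i < j \<longrightarrow> p j < p (Suc i)) \<longleftrightarrow> (\<forall>j<n. i < j \<longrightarrow> xs ! j < xs ! i)" if "i < n" for i
    proof -
      have "(\<forall>j\<in>{1..n}. Suc i < j \<longrightarrow> p j < p (Suc i)) \<longleftrightarrow> (\<forall>j<n. i < j \<longrightarrow> p (Suc j) < p (Suc i))"
        unfolding ball_atLeastAtMost_1 by simp
      also have "\<dots> \<longleftrightarrow> (\<forall>j<n. i < j \<longrightarrow> xs ! j < xs ! i)"
        using destandardize_less_iff[of _ i] that by auto
      finally show ?thesis .
    qed
    then show "i \<in> {1..n} \<and> (\<forall>j\<in>{1..n}. i < j \<longrightarrow> p j < p i) \<longleftrightarrow>
      (\<exists>j. i = Suc j \<and> j < n \<and> (\<forall>k<n. j < k \<longrightarrow> xs ! k < xs ! j))"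
      by (cases i) auto
  qed
  finally show ?thesis by simp
qed

end

lemma card_compatible:
  assumes "n > 0"
  shows "card (compatible n p l) = (l + n - 1 - ides n p) choose n"
proof -
  have "ides n p = card {i. Suc i < n \<and> inv p (Suc (Suc i)) < inv p (Suc i)}"
    unfolding ides_def des_def by (rule card_Suc_image) (auto simp: gr0_conv_Suc Suc_le_eq)
  then show ?thesis by (simp add: card_mono_words assms)
qed

text \<open>Words fibre over permutations by standardization. The three statistics are constant on a
  fibre, and its size depends on the permutation through \<open>ides\<close> alone.\<close>

theorem sum_words_eq_sum_permutations:
  fixes h :: "nat \<Rightarrow> nat \<Rightarrow> nat \<Rightarrow> 'a::comm_semiring_1"
  assumes "n > 0"
  shows "(\<Sum>xs\<in>words n l. h (word_des xs) (word_rmax xs) (word_lmax xs)) =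
    (\<Sum>p | p permutes {1..n}. of_nat ((l + n - 1 - ides n p) choose n) * h (des n p) (rmax n p) (lmax n p))"
proof -
  let ?H = "\<lambda>xs. h (word_des xs) (word_rmax xs) (word_lmax xs)"
  have "(\<Sum>xs\<in>words n l. ?H xs) =
    (\<Sum>(p, ys)\<in>(SIGMA p:{p. p permutes {1..n}}. compatible n p l). ?H (destandardize n p ys))"
    using sum.reindex_bij_betw[OF bij_betw_destandardize, of ?H n l] by (simp add: case_prod_unfold)
  also have "\<dots> = (\<Sum>p | p permutes {1..n}. \<Sum>ys\<in>compatible n p l. ?H (destandardize n p ys))"
    by (rule sum.Sigma[symmetric]) (auto simp: finite_permutations)
  also have "\<dots> = (\<Sum>p | p permutes {1..n}. \<Sum>ys\<in>compatible n p l. h (des n p) (rmax n p) (lmax n p))"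
    by (intro sum.cong refl)
       (simp add: word_des_destandardize word_rmax_destandardize word_lmax_destandardize)
  also have "\<dots> = (\<Sum>p | p permutes {1..n}. of_nat ((l + n - 1 - ides n p) choose n) * h (des n p) (rmax n p) (lmax n p))"
    by (simp add: card_compatible assms)
  finally show ?thesis .
qed

section \<open>Decomposition of words at the last maximum\<close>

definition word_weight :: "'a::comm_semiring_1 \<Rightarrow> 'a \<Rightarrow> 'a \<Rightarrow> nat list \<Rightarrow> 'a" where
  "word_weight u v z xs = u ^ word_des xs * v ^ word_rmax xs * z ^ word_lmax xs"

text \<open>The powers of \<open>1 - u\<close> match the normalization in \<open>gf_summand\<close>;
  the alphabet size \<open>l\<close> takes the place of \<open>x\<close>.\<close>

definition word_gf :: "'a::field \<Rightarrow> 'a \<Rightarrow> 'a \<Rightarrow> nat \<Rightarrow> 'a fps" where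
  "word_gf u v z l = Abs_fps (\<lambda>n. (\<Sum>xs\<in>words n l. word_weight u v z xs) / (1 - u) ^ n)"

lemma card_less_split:
  fixes a k :: nat
  shows "card {i. i < a + k \<and> P i} = card {i. i < a \<and> P i} + card {i. i < k \<and> P (a + i)}"
proof -
  have "{i. i < a + k \<and> P i} = {i. i < a \<and> P i} \<union> (\<lambda>i. a + i) ` {i. i < k \<and> P (a + i)}"
  proof (intro equalityI subsetI)
    fix i assume "i \<in> {i. i < a + k \<and> P i}"
    then show "i \<in> {i. i < a \<and> P i} \<union> (\<lambda>i. a + i) ` {i. i < k \<and> P (a + i)}"
      by (cases "i < a") (auto simp: image_iff intro!: exI[of _ "i - a"])
  qed auto
  moreover have "{i. i < a \<and> P i} \<inter> (\<lambda>i. a + i) ` {i. i < k \<and> P (a + i)} = {}"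
    by auto
  ultimately show ?thesis
    by (simp add: card_Un_disjoint card_image)
qed

lemma card_less_Suc_split:
  "card {i. i < Suc k \<and> P i} = (if P 0 then 1 else 0) + card {i. i < k \<and> P (Suc i)}"
  using card_less_split[of 1 k P] by (cases "P 0") (auto simp: less_Suc_eq cong: conj_cong)

context
  fixes xs ys :: "nat list" and m :: nat
  assumes le: "\<And>x. x \<in> set xs \<Longrightarrow> x \<le> m" and lt: "\<And>y. y \<in> set ys \<Longrightarrow> y < m"
begin

private lemma nths:
  "i < length xs \<Longrightarrow> (xs @ m # ys) ! i = xs ! i"
  "(xs @ m # ys) ! length xs = m"
  "(xs @ m # ys) ! (length xs + Suc j) = ys ! j"
  "i < length xs \<Longrightarrow> xs ! i \<le> m"
  "j < length ys \<Longrightarrow> ys ! j < m"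
  using le lt by (auto simp: nth_append)

text \<open>Letters of \<open>xs\<close> keep their left neighbourhood, \<open>m\<close> is a weak
  maximum, and every letter of \<open>ys\<close> has the larger \<open>m\<close> on its
  left.\<close>

lemma word_lmax_append_max: "word_lmax (xs @ m # ys) = Suc (word_lmax xs)"
proof -
  let ?P = "\<lambda>i. \<forall>j<i. (xs @ m # ys) ! j \<le> (xs @ m # ys) ! i"
  have "word_lmax (xs @ m # ys) = card {i. i < length xs + Suc (length ys) \<and> ?P i}"
    by (simp add: word_lmax_def)
  also have "\<dots> = card {i. i < length xs \<and> ?P i} + card {i. i < Suc (length ys) \<and> ?P (length xs + i)}"
    by (rule card_less_split)
  also have "{i. i < length xs \<and> ?P i} = {i. i < length xs \<and> (\<forall>j<i. xs ! j \<le> xs ! i)}"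
    by (auto simp: nths)
  also have "card {i. i < Suc (length ys) \<and> ?P (length xs + i)} =
      (if ?P (length xs + 0) then 1 else 0) + card {i. i < length ys \<and> ?P (length xs + Suc i)}"
    by (rule card_less_Suc_split)
  also have "?P (length xs + 0) = True"
    by (auto simp: nths)
  also have "{i. i < length ys \<and> ?P (length xs + Suc i)} = {}"
  proof -
    have "\<not> ?P (length xs + Suc i)" if "i < length ys" for i
    proof
      assume "?P (length xs + Suc i)"
      then have "(xs @ m # ys) ! length xs \<le> (xs @ m # ys) ! (length xs + Suc i)"
        by (elim allE[of _ "length xs"] impE) (simp, assumption)
      with nths(5)[OF that] show False by (simp only: nths)
    qed
    then show ?thesis by blast
  qed
  finally show ?thesis by (simp add: word_lmax_def)
qed

text \<open>Every letter of \<open>xs\<close> has on its right an \<open>m\<close> at least as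
  large, while \<open>m\<close> exceeds all of \<open>ys\<close>.\<close>

lemma word_rmax_append_max: "word_rmax (xs @ m # ys) = Suc (word_rmax ys)"
proof -
  let ?n = "length xs + Suc (length ys)"
  let ?P = "\<lambda>i. \<forall>j<?n. i < j \<longrightarrow> (xs @ m # ys) ! j < (xs @ m # ys) ! i"
  have "word_rmax (xs @ m # ys) = card {i. i < ?n \<and> ?P i}"
    by (simp add: word_rmax_def)
  also have "\<dots> = card {i. i < length xs \<and> ?P i} + card {i. i < Suc (length ys) \<and> ?P (length xs + i)}"
    by (rule card_less_split)
  also have "card {i. i < Suc (length ys) \<and> ?P (length xs + i)} =
      (if ?P (length xs + 0) then 1 else 0) + card {i. i < length ys \<and> ?P (length xs + Suc i)}"
    by (rule card_less_Suc_split)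
  also have "{i. i < length xs \<and> ?P i} = {}"
  proof -
    have "\<not> ?P i" if "i < length xs" for i
    proof
      assume "?P i"
      then have "(xs @ m # ys) ! length xs < (xs @ m # ys) ! i"
        using that by (elim allE[of _ "length xs"] impE) (simp, assumption)
      with nths(4)[OF that] that show False by (simp add: nths(1)[OF that])
    qed
    then show ?thesis by blast
  qed
  also have "?P (length xs + 0) = True"
  proof (rule eqTrueI, intro allI impI)
    fix j assume "j < ?n" "length xs + 0 < j"
    then obtain k where "j = length xs + Suc k" "k < length ys"
      by (auto dest!: less_imp_Suc_add)
    then show "(xs @ m # ys) ! j < (xs @ m # ys) ! (length xs + 0)"
      by (simp only: nths add_0_right)
  qed
  also have "{i. i < length ys \<and> ?P (length xs + Suc i)} =
      {i. i < length ys \<and> (\<forall>j<length ys. i < j \<longrightarrow> ys ! j < ys ! i)}"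
  proof -
    have iff: "?P (length xs + Suc i) \<longleftrightarrow> (\<forall>j<length ys. i < j \<longrightarrow> ys ! j < ys ! i)" for i
    proof
      assume P: "?P (length xs + Suc i)"
      show "\<forall>j<length ys. i < j \<longrightarrow> ys ! j < ys ! i"
      proof (intro allI impI)
        fix j assume "j < length ys" "i < j"
        with P have "(xs @ m # ys) ! (length xs + Suc j) < (xs @ m # ys) ! (length xs + Suc i)"
          by (elim allE[of _ "length xs + Suc j"] impE) (simp_all only: add_less_cancel_left Suc_less_eq)
        then show "ys ! j < ys ! i" by (simp only: nths)
      qed
    next
      assume P: "\<forall>j<length ys. i < j \<longrightarrow> ys ! j < ys ! i"
      show "?P (length xs + Suc i)"
      proof (intro allI impI)
        fix j assume "j < ?n" "length xs + Suc i < j"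
        then obtain k where "j = length xs + Suc k" "k < length ys" "i < k"
          by (intro that[of "j - length xs - 1"]) auto
        then show "(xs @ m # ys) ! j < (xs @ m # ys) ! (length xs + Suc i)"
          using P by (simp only: nths)
      qed
    qed
    show ?thesis by (simp only: iff)
  qed
  finally show ?thesis by (simp add: word_rmax_def)
qed

text \<open>The step from \<open>xs\<close> into \<open>m\<close> is a weak ascent; the step out of
  \<open>m\<close> is a descent and exists only for nonempty \<open>ys\<close>.\<close>

lemma word_des_append_max:
  "word_des (xs @ m # ys) = word_des xs + (if ys = [] then 0 else Suc (word_des ys))"
proof -
  let ?P = "\<lambda>i. (xs @ m # ys) ! Suc i < (xs @ m # ys) ! i"
  have P: "?P i \<longleftrightarrow> Suc i < length xs \<and> xs ! Suc i < xs ! i" if "i < length xs" for i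
  proof (cases "Suc i = length xs")
    case True
    then show ?thesis using nths(2) nths(1,4)[OF that] by simp
  next
    case False
    then show ?thesis using that by (simp add: nths)
  qed
  have "word_des (xs @ m # ys) = card {i. i < length xs + length ys \<and> ?P i}"
    by (simp add: word_des_def)
  also have "\<dots> = card {i. i < length xs \<and> ?P i} + card {i. i < length ys \<and> ?P (length xs + i)}"
    by (rule card_less_split)
  also have "{i. i < length xs \<and> ?P i} = {i. Suc i < length xs \<and> xs ! Suc i < xs ! i}"
    using P by auto
  also have "card {i. i < length ys \<and> ?P (length xs + i)} = (if ys = [] then 0 else Suc (word_des ys))"
  proof (cases ys)
    case (Cons y ys')
    have "card {i. i < Suc (length ys') \<and> ?P (length xs + i)} =
      (if ?P (length xs + 0) then 1 else 0) + card {i. i < length ys' \<and> ?P (length xs + Suc i)}"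
      by (rule card_less_Suc_split)
    also have "?P (length xs + 0) = True"
      using nths(2) nths(3)[of 0] nths(5)[of 0] Cons by simp
    also have "{i. i < length ys' \<and> ?P (length xs + Suc i)} = {i. i < length ys' \<and> ys ! Suc i < ys ! i}"
      using nths(3) by (simp flip: add_Suc_right)
    finally show ?thesis
      using Cons by (simp add: word_des_def)
  qed simp
  finally show ?thesis by (simp add: word_des_def)
qed

end

lemma bij_betw_append_max:
  "bij_betw (\<lambda>(a, xs, ys). xs @ m # ys)
     (SIGMA a:{..<n}. words a (Suc m) \<times> words (n - 1 - a) m) (words n (Suc m) - words n m)"
  unfolding bij_betw_def
proof (intro conjI equalityI subsetI)
  have *: "a = b \<and> xs = xs' \<and> ys = ys'"
    if "length xs = a" "length xs' = b" "set ys \<subseteq> {..<m}" "set ys' \<subseteq> {..<m}" "xs @ m # ys = xs' @ m # ys'"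
    for a b xs xs' ys ys'
  proof -
    have "m \<notin> set ys" "m \<notin> set ys'" using that by auto
    \<comment> \<open>Reading from the right up to the first \<open>m\<close> recovers
      \<open>ys\<close>, hence the whole decomposition.\<close>
    moreover have "takeWhile (\<lambda>x. x \<noteq> m) (rev (xs @ m # ys)) = rev ys" if "m \<notin> set ys" for xs ys
    proof -
      have "\<And>y. y \<in> set (rev ys) \<Longrightarrow> y \<noteq> m" using that by auto
      from takeWhile_append2[of "rev ys" "\<lambda>x. x \<noteq> m", OF this] show ?thesis by simp
    qed
    ultimately have "rev ys = rev ys'"
      using that(5) by metis
    then show ?thesis using that by simp
  qed
  show "inj_on (\<lambda>(a, xs, ys). xs @ m # ys) (SIGMA a:{..<n}. words a (Suc m) \<times> words (n - 1 - a) m)"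
  proof (rule inj_onI)
    fix p q
    assume p: "p \<in> (SIGMA a:{..<n}. words a (Suc m) \<times> words (n - 1 - a) m)"
      and q: "q \<in> (SIGMA a:{..<n}. words a (Suc m) \<times> words (n - 1 - a) m)"
      and eq: "(\<lambda>(a, xs, ys). xs @ m # ys) p = (\<lambda>(a, xs, ys). xs @ m # ys) q"
    obtain a xs ys b xs' ys' where [simp]: "p = (a, xs, ys)" "q = (b, xs', ys')"
      by (metis prod_cases3)
    show "p = q"
      using *[of xs a xs' b ys ys'] p q eq by (simp add: words_def)
  qed
next
  fix w assume "w \<in> (\<lambda>(a, xs, ys). xs @ m # ys) ` (SIGMA a:{..<n}. words a (Suc m) \<times> words (n - 1 - a) m)"
  then obtain a xs ys where w: "w = xs @ m # ys" "a < n" "xs \<in> words a (Suc m)" "ys \<in> words (n - 1 - a) m"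
    by auto
  then have "set xs \<subseteq> {..<Suc m}" "set ys \<subseteq> {..<m}" "length w = n"
    by (auto simp: words_def)
  moreover from this(2) have "set ys \<subseteq> {..<Suc m}"
    by (rule order.trans) auto
  ultimately show "w \<in> words n (Suc m) - words n m"
    unfolding words_def w(1) by simp
next
  fix w assume w: "w \<in> words n (Suc m) - words n m"
  then have set_w: "set w \<subseteq> insert m {..<m}" and len: "length w = n" and "m \<in> set w"
    by (auto simp: words_def lessThan_Suc)
  then obtain xs ys where xy: "w = xs @ m # ys" "m \<notin> set ys"
    by (meson split_list_last)
  then have "(length xs, xs, ys) \<in> (SIGMA a:{..<n}. words a (Suc m) \<times> words (n - 1 - a) m)"
    using set_w len by (auto simp: words_def lessThan_Suc)
  then show "w \<in> (\<lambda>(a, xs, ys). xs @ m # ys) ` (SIGMA a:{..<n}. words a (Suc m) \<times> words (n - 1 - a) m)"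
    using xy(1) by (force intro: rev_image_eqI)
qed

lemma words_0 [simp]: "words 0 l = {[]}"
  by (auto simp: words_def)

lemma words_n_0 [simp]: "n > 0 \<Longrightarrow> words n 0 = {}"
  by (auto simp: words_def)

lemma word_weight_Nil [simp]: "word_weight u v z [] = 1"
  by (simp add: word_weight_def word_des_def word_rmax_def word_lmax_def)

lemma word_gf_nth: "fps_nth (word_gf u v z l) n = (\<Sum>xs\<in>words n l. word_weight u v z xs) / (1 - u) ^ n"
  by (simp add: word_gf_def)

lemma word_gf_0: "word_gf u v z 0 = 1"
proof (rule fps_ext)
  fix n show "fps_nth (word_gf u v z 0) n = fps_nth 1 n"
    by (cases "n = 0") (simp_all add: word_gf_nth)
qed

text \<open>In the decomposition at the last maximum the left part keeps only \<open>z\<close>, the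
  right part only \<open>v\<close>, and the separating letter contributes
  \<open>v z t / (1 - u)\<close>.\<close>

lemma word_gf_Suc:
  fixes u v z :: "'a::field"
  assumes u: "u \<noteq> 1"
  shows "word_gf u v z (Suc m) - word_gf u v z m = fps_const (v * z / (1 - u)) * fps_X *
    (word_gf u 1 z (Suc m) * (1 - fps_const u + fps_const u * word_gf u v 1 m))"
proof (rule fps_ext)
  fix n
  let ?R = "1 - fps_const u + fps_const u * word_gf u v 1 m"
  have weight: "word_weight u v z (xs @ m # ys) / (1 - u) ^ n = v * z / (1 - u) *
      (word_weight u 1 z xs / (1 - u) ^ a * ((if ys = [] then 1 else u * word_weight u v 1 ys) / (1 - u) ^ (n - 1 - a)))"
    if "a < n" "xs \<in> words a (Suc m)" "ys \<in> words (n - 1 - a) m" for a xs ys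
  proof -
    have b: "\<And>x. x \<in> set xs \<Longrightarrow> x \<le> m" "\<And>y. y \<in> set ys \<Longrightarrow> y < m"
      using that by (auto simp: words_def less_Suc_eq_le)
    have "(1 - u) ^ n = (1 - u) * ((1 - u) ^ a * (1 - u) ^ (n - 1 - a))"
      using \<open>a < n\<close> by (simp flip: power_Suc power_add)
    then show ?thesis
      using word_des_append_max[of xs m ys] word_lmax_append_max[of xs m ys] word_rmax_append_max[of xs m ys] b
      by (cases "ys = []") (simp_all add: word_weight_def power_add word_des_def[of "[]"] word_rmax_def[of "[]"])
  qed
  \<comment> \<open>The constant term \<open>1 - u + u = 1\<close> belongs to the empty right part;
    each nonempty one gets an extra \<open>u\<close> for the descent after the maximum.\<close>
  have R: "fps_nth ?R k = (\<Sum>ys\<in>words k m. (if ys = [] then 1 else u * word_weight u v 1 ys) / (1 - u) ^ k)" for k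
  proof (cases "k = 0")
    case True
    then show ?thesis by (simp add: word_gf_nth)
  next
    case False
    have "fps_nth ?R k = (\<Sum>ys\<in>words k m. u * word_weight u v 1 ys / (1 - u) ^ k)"
      using False by (simp add: word_gf_nth sum_distrib_left sum_divide_distrib)
    also have "\<dots> = (\<Sum>ys\<in>words k m. (if ys = [] then 1 else u * word_weight u v 1 ys) / (1 - u) ^ k)"
      using False by (intro sum.cong) (auto simp: words_def)
    finally show ?thesis .
  qed
  have "words n m \<subseteq> words n (Suc m)"
    by (auto simp: words_def less_Suc_eq)
  then have "fps_nth (word_gf u v z (Suc m) - word_gf u v z m) n =
    (\<Sum>w\<in>words n (Suc m) - words n m. word_weight u v z w / (1 - u) ^ n)"
    by (simp add: word_gf_nth sum_diff sum_divide_distrib flip: diff_divide_distrib)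
  also have "\<dots> = (\<Sum>(a, xs, ys)\<in>(SIGMA a:{..<n}. words a (Suc m) \<times> words (n - 1 - a) m).
      word_weight u v z (xs @ m # ys) / (1 - u) ^ n)"
    using sum.reindex_bij_betw[OF bij_betw_append_max, of "\<lambda>w. word_weight u v z w / (1 - u) ^ n" m n]
    by (simp add: case_prod_unfold)
  also have "\<dots> = (\<Sum>a<n. \<Sum>(xs, ys)\<in>words a (Suc m) \<times> words (n - 1 - a) m.
      word_weight u v z (xs @ m # ys) / (1 - u) ^ n)"
    by (subst sum.Sigma) (auto simp: case_prod_unfold)
  also have "\<dots> = (\<Sum>a<n. v * z / (1 - u) * (fps_nth (word_gf u 1 z (Suc m)) a * fps_nth ?R (n - 1 - a)))"
  proof (intro sum.cong refl)
    fix a assume a: "a \<in> {..<n}"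
    have "(\<Sum>(xs, ys)\<in>words a (Suc m) \<times> words (n - 1 - a) m. word_weight u v z (xs @ m # ys) / (1 - u) ^ n) =
      (\<Sum>xs\<in>words a (Suc m). \<Sum>ys\<in>words (n - 1 - a) m. v * z / (1 - u) *
      (word_weight u 1 z xs / (1 - u) ^ a * ((if ys = [] then 1 else u * word_weight u v 1 ys) / (1 - u) ^ (n - 1 - a))))"
      unfolding sum.cartesian_product[symmetric] using a weight by (intro sum.cong refl) auto
    also have "\<dots> = v * z / (1 - u) * (fps_nth (word_gf u 1 z (Suc m)) a * fps_nth ?R (n - 1 - a))"
      unfolding R word_gf_nth sum_divide_distrib sum_product by (simp only: sum_distrib_left)
    finally show "(\<Sum>(xs, ys)\<in>words a (Suc m) \<times> words (n - 1 - a) m. word_weight u v z (xs @ m # ys) / (1 - u) ^ n) =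
      v * z / (1 - u) * (fps_nth (word_gf u 1 z (Suc m)) a * fps_nth ?R (n - 1 - a))" .
  qed
  also have "\<dots> = v * z / (1 - u) * (\<Sum>a<n. fps_nth (word_gf u 1 z (Suc m)) a * fps_nth ?R (n - 1 - a))"
    by (rule sum_distrib_left[symmetric])
  also have "\<dots> = fps_nth (fps_const (v * z / (1 - u)) * fps_X * (word_gf u 1 z (Suc m) * ?R)) n"
  proof (cases n)
    case (Suc k)
    have "(\<Sum>a<n. fps_nth (word_gf u 1 z (Suc m)) a * fps_nth ?R (n - 1 - a)) = fps_nth (word_gf u 1 z (Suc m) * ?R) k"
      unfolding fps_mult_nth Suc lessThan_Suc_atMost atLeast0AtMost by simp
    then show ?thesis by (simp add: Suc mult.assoc)
  qed (simp add: mult.assoc)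
  finally show "fps_nth (word_gf u v z (Suc m) - word_gf u v z m) n =
    fps_nth (fps_const (v * z / (1 - u)) * fps_X * (word_gf u 1 z (Suc m) * ?R)) n" .
qed

section \<open>The functional equation\<close>

lemma word_gf_Suc_mult:
  fixes u v z :: "'a::field"
  assumes "u \<noteq> 1"
  shows "(1 - fps_const u) * (word_gf u v z (Suc m) - word_gf u v z m) =
    fps_const v * fps_const z * fps_X * (word_gf u 1 z (Suc m) * (1 - fps_const u + fps_const u * word_gf u v 1 m))"
proof -
  have "(1 - fps_const u) * fps_const (v * z / (1 - u)) = fps_const v * fps_const z"
    using assms by (simp flip: fps_const_1_eq_1)
  then show ?thesis
    by (simp only: word_gf_Suc[OF assms] mult.assoc[symmetric])
qed

section \<open>Solving the recurrences in the alphabet size\<close>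

lemma word_gf_total_step:
  fixes U :: "'a::idom"
  assumes "U \<noteq> 1" and "e = 1 - U + U * E" "e' = 1 - U + U * E'"
    and "(1 - U) * (E' - E) = t * (E' * e)" and "e * (p - U) = (1 - U) * p"
  shows "e' * ((1 - t) * p - U) = (1 - U) * ((1 - t) * p)"
proof -
  have "(1 - U) * (e' * ((1 - t) * p - U)) = (1 - U) * ((1 - U) * ((1 - t) * p))"
    using assms(2-5) by algebra
  then show ?thesis using assms(1) by simp
qed

text \<open>The recurrence is linear in \<open>L'\<close>, and the closed form of \<open>e\<close>
  turns it into a ratio of consecutive terms. Here \<open>p\<close> stands for
  \<open>(1 - t)^l\<close>.\<close>

lemma word_gf_lmax_step:
  fixes U :: "'a::idom"
  assumes "U \<noteq> 1" and "(1 - U) * (L' - L) = Z * t * (L' * e)" and "e * (p - U) = (1 - U) * p"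
  shows "L' * ((1 - Z * t) * p - U) = (p - U) * L"
proof -
  have "(1 - U) * (L' * ((1 - Z * t) * p - U)) = (1 - U) * ((p - U) * L)"
    using assms(2-3) by algebra
  then show ?thesis using assms(1) by simp
qed

text \<open>The closed form of \<open>e'\<close> gives \<open>U E' (p - U) = (1 - U) U\<close>,
  which removes \<open>E'\<close> from the recurrence.\<close>

lemma word_gf_rmax_step:
  fixes U :: "'a::idom"
  assumes "U \<noteq> 1" and "\<rho> = 1 - U + U * R" "\<rho>' = 1 - U + U * R'" "e' = 1 - U + U * E'"
    and "(1 - U) * (R' - R) = V * t * (E' * \<rho>)" and "e' * (p - U) = (1 - U) * p"
  shows "(p - U) * \<rho>' = (p - U + V * t * U) * \<rho>"
proof -
  have "(1 - U) * ((p - U) * \<rho>') = (1 - U) * ((p - U + V * t * U) * \<rho>)"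
    using assms(2-6) by algebra
  then show ?thesis using assms(1) by simp
qed

text \<open>\<open>a\<close> is a product of some \<open>L\<close> and some \<open>\<rho>\<close>;
  the factor \<open>p - U\<close> in their two ratios cancels.\<close>

lemma max_gf_step:
  fixes U :: "'a::idom"
  assumes "U \<noteq> 1" "p \<noteq> U"
    and "(1 - U) * a = w * (L * \<rho>)" "(1 - U) * a' = w * (L' * \<rho>')"
    and "L' * (c * p - U) = (p - U) * L" "(p - U) * \<rho>' = k * \<rho>"
  shows "(c * p - U) * a' = k * a"
proof -
  have "(1 - U) * (p - U) * ((c * p - U) * a') = (1 - U) * (p - U) * (k * a)"
    using assms(3-6) by algebra
  then show ?thesis using assms(1,2) by simp
qed

definition max_gf :: "'a::field \<Rightarrow> 'a \<Rightarrow> 'a \<Rightarrow> nat \<Rightarrow> 'a fps" where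
  "max_gf u v z l = word_gf u v z (Suc l) - word_gf u v z l"

text \<open>
  The number of words of length \<open>n\<close> in which exactly the letters \<open>0, \<dots>, s\<close> occur and whose
  standardization is a given permutation with \<open>d\<close> inverse descents.
\<close>

definition surj_coeff :: "nat \<Rightarrow> nat \<Rightarrow> nat \<Rightarrow> nat" where
  "surj_coeff n d s = (if s < n then (n - 1 - d) choose (n - 1 - s) else 0)"

lemma ides_less: "n > 0 \<Longrightarrow> ides n p < n"
proof -
  assume "n > 0"
  have "ides n p \<le> card {1..<n}"
    unfolding ides_def des_def by (intro card_mono) auto
  with \<open>n > 0\<close> show ?thesis by simp
qed

text \<open>A word with largest letter \<open>l\<close> and \<open>s\<close> other distinct letters
  is fixed by the choice of these among the \<open>l\<close> smaller letters and by a pattern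
  counted by \<open>surj_coeff\<close>.\<close>

lemma surj_coeff_vandermonde:
  assumes "d < n"
  shows "(\<Sum>s\<le>l. (l choose s) * surj_coeff n d s) = (l + n - 1 - d) choose (n - 1)"
proof -
  have "(\<Sum>s\<le>l. (l choose s) * surj_coeff n d s) = (\<Sum>s\<le>n - 1. (l choose s) * ((n - 1 - d) choose (n - 1 - s)))"
  proof (rule sum.mono_neutral_cong)
    fix s assume "s \<in> {..l} - {..n - 1}"
    then have "\<not> s < n" using assms by auto
    then show "(l choose s) * surj_coeff n d s = 0" by (simp add: surj_coeff_def)
  qed (use assms in \<open>auto simp: surj_coeff_def\<close>)
  also have "\<dots> = (l + (n - 1 - d)) choose (n - 1)"
    by (rule vandermonde)
  finally show ?thesis using assms by simp
qed

text \<open>Reversing the sum gives the binomial expansion of \<open>(1 + x I)^(n-1-d)\<close>, and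
  \<open>1 + x I = I\<close>. This expands the \<open>x\<close>-part of a summand of
  \<open>gf\<close> in powers of \<open>x / (1 - x)\<close>.\<close>

lemma sum_surj_coeff_power:
  fixes x I :: "'a::comm_ring_1"
  assumes "d < n" "(1 - x) * I = 1"
  shows "I * (\<Sum>s<n. of_nat (surj_coeff n d s) * (x * I) ^ s) = x ^ d * I ^ n"
proof -
  define m where "m = n - 1 - d"
  have n: "n = Suc (d + m)" using assms by (simp add: m_def)
  have "(\<Sum>s<n. of_nat (surj_coeff n d s) * (x * I) ^ s) = (\<Sum>i<n. of_nat (m choose i) * (x * I) ^ (d + m - i))"
    by (rule sum.reindex_bij_witness[of _ "\<lambda>i. d + m - i" "\<lambda>i. d + m - i"])
       (auto simp: n surj_coeff_def)
  also have "\<dots> = (\<Sum>i\<le>m. of_nat (m choose i) * (x * I) ^ (d + m - i))"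
  proof (rule sum.mono_neutral_right)
    show "\<forall>i\<in>{..<n} - {..m}. of_nat (m choose i) * (x * I) ^ (d + m - i) = 0"
      by (intro ballI) (simp add: binomial_eq_0)
  qed (auto simp: n)
  also have "\<dots> = (x * I) ^ d * (\<Sum>i\<le>m. of_nat (m choose i) * 1 ^ i * (x * I) ^ (m - i))"
    unfolding sum_distrib_left
  proof (intro sum.cong refl)
    fix i assume "i \<in> {..m}"
    then have "(x * I) ^ (d + m - i) = (x * I) ^ d * (x * I) ^ (m - i)"
      by (simp flip: power_add)
    then show "of_nat (m choose i) * (x * I) ^ (d + m - i) = (x * I) ^ d * (of_nat (m choose i) * 1 ^ i * (x * I) ^ (m - i))"
      by (simp only: power_one mult_1_right mult.left_commute)
  qed
  also have "\<dots> = (x * I) ^ d * (1 + x * I) ^ m"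
    by (simp only: binomial_ring)
  also have "1 + x * I = I"
  proof -
    have "(1 - x) * I + x * I = I" by (simp add: algebra_simps)
    then show ?thesis by (simp only: assms(2))
  qed
  finally show ?thesis
    by (simp add: n power_add power_mult_distrib ac_simps)
qed

definition perm_weight :: "'a::field \<Rightarrow> 'a \<Rightarrow> 'a \<Rightarrow> nat \<Rightarrow> (nat \<Rightarrow> nat) \<Rightarrow> 'a" where
  "perm_weight u v z n p = u ^ des n p * v ^ rmax n p * z ^ lmax n p / (1 - u) ^ n"

text \<open>The inverse binomial transform of \<open>max_gf\<close>. It is divisible by
  \<open>t^(s+1)\<close>, so its sum against the powers of \<open>x / (1 - x)\<close> converges
  t-adically.\<close>

definition surj_gf :: "'a::field \<Rightarrow> 'a \<Rightarrow> 'a \<Rightarrow> nat \<Rightarrow> 'a fps" where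
  "surj_gf u v z s = Abs_fps (\<lambda>n. \<Sum>p | p permutes {1..n}. of_nat (surj_coeff n (ides n p) s) * perm_weight u v z n p)"

context
  fixes u v z :: "'a::field"
  assumes u: "u \<noteq> 1"
begin

private abbreviation "U \<equiv> fps_const u"
private abbreviation "V \<equiv> fps_const v"
private abbreviation "Z \<equiv> fps_const z"

private lemma U_neq_1: "U \<noteq> 1"
proof
  assume "U = 1"
  then have "fps_nth U 0 = fps_nth 1 0" by simp
  with u show False by simp
qed

private lemma power_neq_U: "(1 - fps_X) ^ l \<noteq> U"
proof
  assume "(1 - fps_X) ^ l = U"
  then have "fps_nth ((1 - fps_X) ^ l) 0 = fps_nth U 0" by (rule arg_cong)
  with u show False by (simp add: fps_power_zeroth)
qed

lemma word_gf_total: "(1 - U + U * word_gf u 1 1 l) * ((1 - fps_X) ^ l - U) = (1 - U) * (1 - fps_X) ^ l"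
proof (induction l)
  case (Suc l)
  show ?case
    using word_gf_total_step[OF U_neq_1 refl refl _ Suc, of "word_gf u 1 1 (Suc l)" fps_X]
      word_gf_Suc_mult[OF u, of 1 1 l] by simp
qed (simp add: word_gf_0)

lemma max_gf_Suc:
  "((1 - Z * fps_X) * (1 - fps_X) ^ Suc l - U) * max_gf u v z (Suc l) =
   ((1 - fps_X) ^ Suc l - U + V * fps_X * U) * max_gf u v z l"
proof (rule max_gf_step[OF U_neq_1 power_neq_U])
  have rec: "(1 - U) * max_gf u v z l = V * Z * fps_X * (word_gf u 1 z (Suc l) * (1 - U + U * word_gf u v 1 l))" for l
    unfolding max_gf_def by (rule word_gf_Suc_mult[OF u])
  show "(1 - U) * max_gf u v z l = V * Z * fps_X * (word_gf u 1 z (Suc l) * (1 - U + U * word_gf u v 1 l))"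
    by (rule rec)
  show "(1 - U) * max_gf u v z (Suc l) =
      V * Z * fps_X * (word_gf u 1 z (Suc (Suc l)) * (1 - U + U * word_gf u v 1 (Suc l)))"
    by (rule rec)
  show "word_gf u 1 z (Suc (Suc l)) * ((1 - Z * fps_X) * (1 - fps_X) ^ Suc l - U) =
      ((1 - fps_X) ^ Suc l - U) * word_gf u 1 z (Suc l)"
    by (rule word_gf_lmax_step[OF U_neq_1 _ word_gf_total]) (use word_gf_Suc_mult[OF u, of 1 z "Suc l"] in simp)
  show "((1 - fps_X) ^ Suc l - U) * (1 - U + U * word_gf u v 1 (Suc l)) =
    ((1 - fps_X) ^ Suc l - U + V * fps_X * U) * (1 - U + U * word_gf u v 1 l)"
    by (rule word_gf_rmax_step[OF U_neq_1 refl refl refl _ word_gf_total]) (use word_gf_Suc_mult[OF u, of v 1 l] in simp)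
qed

lemma max_gf_0: "(1 - Z * fps_X - U) * max_gf u v z 0 = V * Z * fps_X"
proof -
  have a: "(1 - U) * max_gf u v z 0 = V * Z * fps_X * word_gf u 1 z 1"
    using word_gf_Suc_mult[OF u, of v z 0] by (simp add: max_gf_def word_gf_0)
  have "word_gf u 1 z 1 * ((1 - Z * fps_X) * 1 - U) = (1 - U) * 1"
    by (rule word_gf_lmax_step[OF U_neq_1, of _ _ _ _ 1]) (use word_gf_Suc_mult[OF u, of 1 z 0] in \<open>simp_all add: word_gf_0\<close>)
  with a have "(1 - U) * ((1 - Z * fps_X - U) * max_gf u v z 0) = (1 - U) * (V * Z * fps_X)"
    by algebra
  then show ?thesis using U_neq_1 by simp
qed

lemma surj_gf_nth_eq_0: "n \<le> s \<Longrightarrow> fps_nth (surj_gf u v z s) n = 0"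
  by (simp add: surj_gf_def surj_coeff_def)

text \<open>Both sides are sums over permutations. By Pascal's rule the difference in
  \<open>l\<close> of the fibre sizes is a binomial coefficient over \<open>n - 1\<close>, which
  Vandermonde's convolution splits.\<close>

lemma max_gf_eq: "max_gf u v z l = (\<Sum>s\<le>l. of_nat (l choose s) * surj_gf u v z s)"
proof (rule fps_ext)
  fix n :: nat
  let ?P = "{p. p permutes {1..n}}"
  have R: "fps_nth (\<Sum>s\<le>l. of_nat (l choose s) * surj_gf u v z s) n =
      (\<Sum>p\<in>?P. of_nat (\<Sum>s\<le>l. (l choose s) * surj_coeff n (ides n p) s) * perm_weight u v z n p)"
  proof -
    have "fps_nth (\<Sum>s\<le>l. of_nat (l choose s) * surj_gf u v z s) n =
      (\<Sum>s\<le>l. \<Sum>p\<in>?P. of_nat (l choose s) * (of_nat (surj_coeff n (ides n p) s) * perm_weight u v z n p))"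
      by (simp add: fps_sum_nth surj_gf_def sum_distrib_left fps_of_nat[symmetric] del: fps_of_nat)
    also have "\<dots> = (\<Sum>p\<in>?P. \<Sum>s\<le>l. of_nat (l choose s) * (of_nat (surj_coeff n (ides n p) s) * perm_weight u v z n p))"
      by (rule sum.swap)
    finally show ?thesis
      by (simp add: sum_distrib_right mult.assoc)
  qed
  show "fps_nth (max_gf u v z l) n = fps_nth (\<Sum>s\<le>l. of_nat (l choose s) * surj_gf u v z s) n"
  proof (cases "n = 0")
    case True
    then show ?thesis unfolding R by (simp add: max_gf_def word_gf_nth surj_coeff_def)
  next
    case False
    have F: "fps_nth (word_gf u v z l) n = (\<Sum>p\<in>?P. of_nat ((l + n - 1 - ides n p) choose n) * perm_weight u v z n p)" for l
      using False sum_words_eq_sum_permutations[of n "\<lambda>a b c. u ^ a * v ^ b * z ^ c" l]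
      by (simp add: word_gf_nth word_weight_def sum_divide_distrib perm_weight_def)
    have "of_nat ((Suc l + n - 1 - d) choose n) * w - of_nat ((l + n - 1 - d) choose n) * w =
        of_nat ((l + n - 1 - d) choose (n - 1)) * w" if "d < n" for d and w :: 'a
    proof -
      have "Suc l + n - 1 - d = Suc (l + n - 1 - d)" "n = Suc (n - 1)"
        using that by linarith+
      then have "(Suc l + n - 1 - d) choose n = ((l + n - 1 - d) choose (n - 1)) + ((l + n - 1 - d) choose n)"
        by (metis binomial_Suc_Suc)
      then show ?thesis by (simp add: algebra_simps)
    qed
    then show ?thesis
      unfolding R max_gf_def fps_sub_nth F sum_subtractf[symmetric] using False
      by (intro sum.cong refl) (simp add: surj_coeff_vandermonde ides_less)
  qed
qed

lemma gf_summand_eq: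
  assumes x: "fps_nth x 0 \<noteq> 1" and n: "n > 0"
  defines "I \<equiv> inverse (1 - x)"
  shows "gf_summand x U V 1 Z n = I * (\<Sum>s<n. (x * I) ^ s * fps_const (fps_nth (surj_gf u v z s) n))"
proof -
  have I: "(1 - x) * I = 1"
    unfolding I_def using x by (intro inverse_mult_eq_1') simp
  have "(U ^ des n p * x ^ ides n p * 1 ^ lmin n p * V ^ rmax n p * Z ^ lmax n p) / ((1 - U) ^ n * (1 - x) ^ n) =
      fps_const (perm_weight u v z n p) * (x ^ ides n p * I ^ n)" for p
  proof -
    have c: "(1 - U) ^ n * fps_const (1 / (1 - u) ^ n) = 1"
    proof -
      have "(1 - U) ^ n = fps_const ((1 - u) ^ n)"
        by (simp flip: fps_const_1_eq_1 fps_const_power)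
      then show ?thesis using u by simp
    qed
    have "((1 - U) ^ n * (1 - x) ^ n) * (fps_const (perm_weight u v z n p) * (x ^ ides n p * I ^ n)) =
       (U ^ des n p * x ^ ides n p * 1 ^ lmin n p * V ^ rmax n p * Z ^ lmax n p)"
    proof -
      have w: "fps_const (perm_weight u v z n p) = U ^ des n p * V ^ rmax n p * Z ^ lmax n p * fps_const (1 / (1 - u) ^ n)"
        by (simp add: perm_weight_def fps_const_power)
      have i: "(1 - x) ^ n * I ^ n = 1"
        using I by (simp flip: power_mult_distrib)
      have "(a * b) * ((c1 * c2 * c3 * d) * (e * f)) = (c1 * e * 1 * c2 * c3) * (a * d) * (b * f)" for a b c1 c2 c3 d e f :: "'a fps"
        by (simp add: ac_simps)
      then show ?thesis unfolding w by (simp only: c i mult_1_right power_one)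
    qed
    moreover have "(1 - U) ^ n * (1 - x) ^ n \<noteq> 0"
    proof -
      have "1 - U \<noteq> 0" "1 - x \<noteq> 0" using U_neq_1 I by auto
      then show ?thesis by simp
    qed
    ultimately show ?thesis
      by (metis nonzero_mult_div_cancel_left)
  qed
  then have "gf_summand x U V 1 Z n = (\<Sum>p | p permutes {1..n}. fps_const (perm_weight u v z n p) * (x ^ ides n p * I ^ n))"
    by (simp add: gf_summand_def)
  also have "\<dots> = (\<Sum>p | p permutes {1..n}. \<Sum>s<n. I * ((x * I) ^ s * (of_nat (surj_coeff n (ides n p) s) * fps_const (perm_weight u v z n p))))"
  proof (intro sum.cong refl)
    fix p
    have "fps_const (perm_weight u v z n p) * (x ^ ides n p * I ^ n) =
        fps_const (perm_weight u v z n p) * (I * (\<Sum>s<n. of_nat (surj_coeff n (ides n p) s) * (x * I) ^ s))"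
      by (simp only: sum_surj_coeff_power[OF ides_less[OF n] I])
    also have "\<dots> = (\<Sum>s<n. I * ((x * I) ^ s * (of_nat (surj_coeff n (ides n p) s) * fps_const (perm_weight u v z n p))))"
      unfolding sum_distrib_left by (intro sum.cong refl) (simp only: ac_simps)
    finally show "fps_const (perm_weight u v z n p) * (x ^ ides n p * I ^ n) =
        (\<Sum>s<n. I * ((x * I) ^ s * (of_nat (surj_coeff n (ides n p) s) * fps_const (perm_weight u v z n p))))" .
  qed
  also have "\<dots> = (\<Sum>s<n. \<Sum>p | p permutes {1..n}. I * ((x * I) ^ s * (of_nat (surj_coeff n (ides n p) s) * fps_const (perm_weight u v z n p))))"
    by (rule sum.swap)
  also have "\<dots> = (\<Sum>s<n. I * ((x * I) ^ s * fps_const (fps_nth (surj_gf u v z s) n)))"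
  proof (intro sum.cong refl)
    fix s
    have "fps_const (fps_nth (surj_gf u v z s) n) = (\<Sum>p | p permutes {1..n}. of_nat (surj_coeff n (ides n p) s) * fps_const (perm_weight u v z n p))"
      by (simp add: surj_gf_def fps_of_nat[symmetric] del: fps_of_nat) (simp add: fps_eq_iff fps_sum_nth)
    then show "(\<Sum>p | p permutes {1..n}. I * ((x * I) ^ s * (of_nat (surj_coeff n (ides n p) s) * fps_const (perm_weight u v z n p)))) =
      I * ((x * I) ^ s * fps_const (fps_nth (surj_gf u v z s) n))"
      by (simp add: sum_distrib_left)
  qed
  finally show ?thesis by (simp add: sum_distrib_left)
qed

text \<open>Since \<open>surj_gf u v z s\<close> is divisible by \<open>t^(s+1)\<close>, cutting
  both the length \<open>n\<close> and the index \<open>s\<close> at \<open>N\<close> changes the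
  series only by multiples of \<open>t^N\<close>.\<close>

lemma gf_approx:
  assumes x: "fps_nth x 0 \<noteq> 1"
  defines "I \<equiv> inverse (1 - x)"
  shows "fps_X ^ N dvd gf x U V 1 Z - I * (\<Sum>s<N. (x * I) ^ s * surj_gf u v z s)"
proof -
  let ?c = "\<lambda>s n. fps_const (fps_nth (surj_gf u v z s) n)"
  let ?S = "\<lambda>n. gf_summand x U V 1 Z (Suc n)"
  let ?T = "\<lambda>s. \<Sum>n<N. fps_X ^ Suc n * ?c s (Suc n)"
  have "fps_X ^ N dvd gf x U V 1 Z - (\<Sum>n<N. fps_X ^ Suc n * ?S n)"
    unfolding fps_X_power_dvd_iff
  proof (intro allI impI)
    fix k assume "k < N"
    then have "(\<Sum>n<N. fps_nth (fps_X ^ Suc n * ?S n) k) = (\<Sum>n<k. fps_nth (fps_X ^ Suc n * ?S n) k)"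
      by (intro sum.mono_neutral_right) (auto simp: fps_X_power_mult_nth simp del: power_Suc)
    then show "fps_nth (gf x U V 1 Z - (\<Sum>n<N. fps_X ^ Suc n * ?S n)) k = 0"
      by (simp add: fps_sum_nth gf_nth fps_X_power_mult_nth del: power_Suc)
  qed
  moreover have "(\<Sum>n<N. fps_X ^ Suc n * ?S n) = I * (\<Sum>s<N. (x * I) ^ s * ?T s)"
  proof -
    have "?S n = I * (\<Sum>s<N. (x * I) ^ s * ?c s (Suc n))" if "n < N" for n
    proof -
      \<comment> \<open>The added coefficients vanish; a range of \<open>s\<close> independent of
        \<open>n\<close> lets the sums be exchanged.\<close>
      have "(\<Sum>s<Suc n. (x * I) ^ s * ?c s (Suc n)) = (\<Sum>s<N. (x * I) ^ s * ?c s (Suc n))"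
        using that by (intro sum.mono_neutral_left) (auto simp: surj_gf_nth_eq_0)
      then show ?thesis
        using gf_summand_eq[OF x, of "Suc n"] by (simp add: I_def)
    qed
    then have "(\<Sum>n<N. fps_X ^ Suc n * ?S n) = (\<Sum>n<N. fps_X ^ Suc n * (I * (\<Sum>s<N. (x * I) ^ s * ?c s (Suc n))))"
      by (intro sum.cong) auto
    also have "\<dots> = (\<Sum>n<N. \<Sum>s<N. I * ((x * I) ^ s * (fps_X ^ Suc n * ?c s (Suc n))))"
      by (simp add: sum_distrib_left mult.left_commute)
    also have "\<dots> = (\<Sum>s<N. \<Sum>n<N. I * ((x * I) ^ s * (fps_X ^ Suc n * ?c s (Suc n))))"
      by (rule sum.swap)
    finally show ?thesis by (simp add: sum_distrib_left)
  qed
  moreover have "fps_X ^ N dvd I * (\<Sum>s<N. (x * I) ^ s * surj_gf u v z s) - I * (\<Sum>s<N. (x * I) ^ s * ?T s)"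
  proof -
    have "fps_X ^ N dvd surj_gf u v z s - ?T s" for s
      unfolding fps_X_power_dvd_iff
    proof (intro allI impI)
      fix k assume k: "k < N"
      have "fps_nth (?T s) k = (\<Sum>n<N. if n = k - 1 \<and> k > 0 then fps_nth (surj_gf u v z s) k else 0)"
        by (auto simp: fps_sum_nth fps_X_power_mult_nth simp del: power_Suc intro!: sum.cong)
      also have "\<dots> = fps_nth (surj_gf u v z s) k"
        using k by (cases k) (simp_all add: surj_gf_nth_eq_0)
      finally show "fps_nth (surj_gf u v z s - ?T s) k = 0" by simp
    qed
    then have "fps_X ^ N dvd I * (\<Sum>s<N. (x * I) ^ s * (surj_gf u v z s - ?T s))"
      by (intro dvd_mult dvd_sum)
    then show ?thesis by (simp add: right_diff_distrib sum_subtractf)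
  qed
  ultimately show ?thesis
    using dvd_diff[of "fps_X ^ N" "gf x U V 1 Z - (\<Sum>n<N. fps_X ^ Suc n * ?S n)"
        "I * (\<Sum>s<N. (x * I) ^ s * surj_gf u v z s) - I * (\<Sum>s<N. (x * I) ^ s * ?T s)"]
    by (simp only: diff_diff_eq2 diff_add_cancel)
qed

text \<open>The recurrence \<open>max_gf_Suc\<close> passes to generating functions by
  \<open>binomial_transform_functional_equation\<close> with \<open>c = 1 - z t\<close>,
  \<open>d = u\<close> and \<open>e = u - v t u\<close>.\<close>

theorem gf_functional_equation:
  assumes x: "fps_nth x 0 \<noteq> 1"
  shows "U * (1 - x + x * V * fps_X) * gf x U V 1 Z =
    (1 - Z * fps_X - x * (1 - fps_X)) * gf (x * (1 - fps_X)) U V 1 Z - V * Z * fps_X"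
proof (rule fps_eqI_X_power_dvd)
  fix N
  define I where "I = inverse (1 - x)"
  define y where "y = x * (1 - fps_X)"
  define K where "K = inverse (1 - y)"
  define J where "J = inverse (1 + fps_X * (x * I))"
  have y: "fps_nth y 0 \<noteq> 1" using x by (simp add: y_def)
  have I: "(1 - x) * I = 1"
    unfolding I_def using x by (intro inverse_mult_eq_1') simp
  have K: "(1 - y) * K = 1"
    unfolding K_def using y by (intro inverse_mult_eq_1') simp
  have J: "(1 + fps_X * (x * I)) * J = 1"
    unfolding J_def by (intro inverse_mult_eq_1') simp
  \<comment> \<open>This is \<open>1 - x (1 - t) = (1 - x) (1 + t x I)\<close> inverted.\<close>
  have KIJ: "K = I * J"
    using I J K unfolding y_def by algebra
  let ?\<Phi> = "\<lambda>w. \<Sum>s<N. w ^ s * surj_gf u v z s"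
  have "fps_X ^ N dvd ((1 - Z * fps_X) * (1 + x * I) - (1 - fps_X) * (x * I)) * (J * ?\<Phi> (y * K))
       - (U * (1 + x * I) - (U - V * fps_X * U) * (x * I)) * ?\<Phi> (x * I) - (1 - Z * fps_X - U) * max_gf u v z 0"
  proof (rule binomial_transform_functional_equation[OF _ _ J max_gf_eq])
    show "fps_X ^ s dvd surj_gf u v z s" for s
      by (simp add: fps_X_power_dvd_iff surj_gf_nth_eq_0)
    show "y * K * (1 + fps_X * (x * I)) = (1 - fps_X) * (x * I)"
      unfolding KIJ y_def using J by algebra
    show "((1 - Z * fps_X) * (1 - fps_X) ^ Suc l - U) * max_gf u v z (Suc l) =
        ((1 - fps_X) ^ Suc l - (U - V * fps_X * U)) * max_gf u v z l" for l
      using max_gf_Suc[of l] by (simp add: algebra_simps)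
  qed
  moreover have "(U * (1 + x * I) - (U - V * fps_X * U) * (x * I)) = U * (1 - x + x * V * fps_X) * I"
    using I by algebra
  moreover have "((1 - Z * fps_X) * (1 + x * I) - (1 - fps_X) * (x * I)) * (J * ?\<Phi> (y * K)) =
      (1 - Z * fps_X - y) * (K * ?\<Phi> (y * K))"
  proof -
    have "((1 - Z * fps_X) * (1 + x * I) - (1 - fps_X) * (x * I)) * J = (1 - Z * fps_X - y) * K"
      unfolding KIJ y_def using I by algebra
    then show ?thesis by (simp only: mult.assoc[symmetric])
  qed
  ultimately have main: "fps_X ^ N dvd (1 - Z * fps_X - y) * (K * ?\<Phi> (y * K))
       - U * (1 - x + x * V * fps_X) * (I * ?\<Phi> (x * I)) - V * Z * fps_X"
    by (simp only: max_gf_0 mult.assoc)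
  have G: "fps_X ^ N dvd gf x U V 1 Z - I * ?\<Phi> (x * I)"
    unfolding I_def by (rule gf_approx[OF x])
  have H: "fps_X ^ N dvd gf y U V 1 Z - K * ?\<Phi> (y * K)"
    unfolding K_def by (rule gf_approx[OF y])
  have "a * g - (b * h - w) = a * (g - g') - b * (h - h') - (b * h' - a * g' - w)" for a b g h g' h' w :: "'a fps"
    by (simp add: algebra_simps)
  then have "U * (1 - x + x * V * fps_X) * gf x U V 1 Z - ((1 - Z * fps_X - y) * gf y U V 1 Z - V * Z * fps_X) =
     U * (1 - x + x * V * fps_X) * (gf x U V 1 Z - I * ?\<Phi> (x * I))
     - (1 - Z * fps_X - y) * (gf y U V 1 Z - K * ?\<Phi> (y * K))
     - ((1 - Z * fps_X - y) * (K * ?\<Phi> (y * K))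
       - U * (1 - x + x * V * fps_X) * (I * ?\<Phi> (x * I)) - V * Z * fps_X)" .
  also have "fps_X ^ N dvd \<dots>"
    by (intro dvd_diff dvd_mult G H main)
  finally show "fps_X ^ N dvd U * (1 - x + x * V * fps_X) * gf x U V 1 Z -
    ((1 - Z * fps_X - x * (1 - fps_X)) * gf (x * (1 - fps_X)) U V 1 Z - V * Z * fps_X)"
    unfolding y_def .
qed

end

section \<open>Laurent series in \<open>1/u\<close>\<close>

text \<open>A bound on the \<open>1/u\<close>-adic valuation, uniform in the power of
  \<open>t\<close>; applied to differences it expresses congruence modulo
  \<open>(1/u)^M\<close>.\<close>

definition coeffs_ord_ge :: "int \<Rightarrow> 'a::field fls fps \<Rightarrow> bool" where
  "coeffs_ord_ge M f \<longleftrightarrow> (\<forall>k. \<forall>i<M. fls_nth (fps_nth f k) i = 0)"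

lemma coeffs_ord_ge_mono: "coeffs_ord_ge M f \<Longrightarrow> N \<le> M \<Longrightarrow> coeffs_ord_ge N f"
  by (auto simp: coeffs_ord_ge_def)

lemma coeffs_ord_ge_add: "coeffs_ord_ge M f \<Longrightarrow> coeffs_ord_ge M g \<Longrightarrow> coeffs_ord_ge M (f + g)"
  by (auto simp: coeffs_ord_ge_def)

lemma coeffs_ord_ge_diff: "coeffs_ord_ge M f \<Longrightarrow> coeffs_ord_ge M g \<Longrightarrow> coeffs_ord_ge M (f - g)"
  by (auto simp: coeffs_ord_ge_def)

lemma coeffs_ord_ge_zero: "coeffs_ord_ge M 0"
  by (auto simp: coeffs_ord_ge_def)

lemma coeffs_ord_ge_sum: "(\<And>i. i \<in> A \<Longrightarrow> coeffs_ord_ge M (f i)) \<Longrightarrow> coeffs_ord_ge M (sum f A)"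
  by (induction A rule: infinite_finite_induct) (auto intro: coeffs_ord_ge_add coeffs_ord_ge_zero)

lemma coeffs_ord_ge_one: "coeffs_ord_ge 0 1"
  by (auto simp: coeffs_ord_ge_def fps_one_nth)

lemma coeffs_ord_ge_X: "coeffs_ord_ge 0 fps_X"
  by (auto simp: coeffs_ord_ge_def fps_X_nth)

lemma coeffs_ord_ge_scalar: "coeffs_ord_ge 0 (scalar c)"
  by (auto simp: coeffs_ord_ge_def)

lemma coeffs_ord_ge_fls_X: "coeffs_ord_ge 1 (fps_const fls_X)"
  by (auto simp: coeffs_ord_ge_def)

lemma coeffs_ord_ge_fls_X_inv: "coeffs_ord_ge (-1) (fps_const fls_X_inv)"
  by (auto simp: coeffs_ord_ge_def)

lemma fls_mult_nth_eq_0: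
  fixes f g :: "'a::field fls"
  assumes "\<And>i. i < M \<Longrightarrow> fls_nth f i = 0" "\<And>i. i < N \<Longrightarrow> fls_nth g i = 0" "i < M + N"
  shows "fls_nth (f * g) i = 0"
proof (cases "f = 0 \<or> g = 0")
  case False
  then have "M \<le> fls_subdegree f" "N \<le> fls_subdegree g"
    using assms by (auto intro: fls_subdegree_geI)
  then show ?thesis using assms(3) by (intro fls_times_nth_eq0) linarith
qed auto

lemma coeffs_ord_ge_mult:
  assumes "coeffs_ord_ge M f" "coeffs_ord_ge N g"
  shows "coeffs_ord_ge (M + N) (f * g)"
proof -
  have "fls_nth (fps_nth f i * fps_nth g j) k = 0" if "k < M + N" for i j k
    using assms that by (intro fls_mult_nth_eq_0[of M _ N]) (auto simp: coeffs_ord_ge_def)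
  then show ?thesis
    by (auto simp: coeffs_ord_ge_def fps_mult_nth fls_nth_sum intro!: sum.neutral)
qed

lemma coeffs_ord_ge_mult_le:
  assumes "coeffs_ord_ge M f" "coeffs_ord_ge N g" "K \<le> M + N"
  shows "coeffs_ord_ge K (f * g)"
  using coeffs_ord_ge_mono[OF coeffs_ord_ge_mult] assms by blast

lemma coeffs_ord_ge_power: "coeffs_ord_ge 0 f \<Longrightarrow> coeffs_ord_ge 0 (f ^ n)"
  by (induction n) (auto intro: coeffs_ord_ge_one coeffs_ord_ge_mult_le)

text \<open>The constant coefficient of \<open>h\<close> is a unit of \<open>K[[1/u]]\<close>, so
  \<open>h\<close> is a unit of \<open>K[[1/u]][[t]]\<close>. The bound is obtained one power of
  \<open>t\<close> after another.\<close>

lemma coeffs_ord_ge_cancel: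
  assumes qh: "coeffs_ord_ge M (q * h)" and h: "coeffs_ord_ge 0 h"
    and h0: "fps_nth h 0 \<noteq> 0" "fls_subdegree (fps_nth h 0) = 0"
  shows "coeffs_ord_ge M q"
proof -
  have "\<forall>i<M. fls_nth (fps_nth q k) i = 0" for k
  proof (induction k rule: less_induct)
    case (less k)
    have "fps_nth (q * h) k = fps_nth q k * fps_nth h 0 + (\<Sum>i<k. fps_nth q i * fps_nth h (k - i))"
      by (simp add: fps_mult_nth atLeast0AtMost flip: lessThan_Suc_atMost)
    then have eq: "fps_nth q k * fps_nth h 0 = fps_nth (q * h) k - (\<Sum>i<k. fps_nth q i * fps_nth h (k - i))"
      by simp
    have "fls_nth (fps_nth q i * fps_nth h (k - i)) j = 0" if "i < k" "j < M" for i j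
      using less[of i] h that by (intro fls_mult_nth_eq_0[of M _ 0]) (auto simp: coeffs_ord_ge_def)
    then have 0: "fls_nth (fps_nth q k * fps_nth h 0) j = 0" if "j < M" for j
      unfolding eq using qh that by (auto simp: coeffs_ord_ge_def fls_nth_sum intro!: sum.neutral)
    show ?case
    proof (cases "fps_nth q k = 0")
      case False
      then have "M \<le> fls_subdegree (fps_nth q k * fps_nth h 0)"
        using h0 0 by (intro fls_subdegree_geI) auto
      then show ?thesis using False h0 by simp
    qed auto
  qed
  then show ?thesis by (auto simp: coeffs_ord_ge_def)
qed

lemma coeffs_ord_ge_cancel_X:
  assumes "coeffs_ord_ge M (fps_X * f)"
  shows "coeffs_ord_ge M f"
  unfolding coeffs_ord_ge_def
proof (intro allI impI)
  fix k i assume "i < M"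
  with assms have "fls_nth (fps_nth (fps_X * f) (Suc k)) i = 0"
    unfolding coeffs_ord_ge_def by blast
  then show "fls_nth (fps_nth f k) i = 0" by simp
qed

text \<open>Completeness: only the terms with \<open>m \<le> i\<close> reach the coefficient of
  \<open>(1/u)^i\<close>, so each coefficient of the limit is a finite sum.\<close>

lemma coeffs_ord_ge_summable:
  assumes "\<And>m. coeffs_ord_ge (int m) (f m)"
  shows "\<exists>s. \<forall>M. coeffs_ord_ge (int M) (s - (\<Sum>m<M. f m))"
proof
  let ?c = "\<lambda>k i. if i < 0 then 0 else \<Sum>m<Suc (nat i). fls_nth (fps_nth (f m) k) i"
  let ?s = "Abs_fps (\<lambda>k. Abs_fls (?c k))"
  show "\<forall>M. coeffs_ord_ge (int M) (?s - (\<Sum>m<M. f m))"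
    unfolding coeffs_ord_ge_def
  proof (intro allI impI)
    fix M :: nat and k i assume i: "i < int M"
    have s: "fls_nth (fps_nth ?s k) i = ?c k i"
      by (simp add: nth_Abs_fls_lower_bound[of 0])
    have "(\<Sum>m<M. fls_nth (fps_nth (f m) k) i) = ?c k i"
    proof (cases "i < 0")
      case True
      then have "fls_nth (fps_nth (f m) k) i = 0" for m
        using assms[of m] by (auto simp: coeffs_ord_ge_def)
      then show ?thesis using True by simp
    next
      case False
      have "(\<Sum>m<M. fls_nth (fps_nth (f m) k) i) = (\<Sum>m<Suc (nat i). fls_nth (fps_nth (f m) k) i)"
      proof (rule sum.mono_neutral_right)
        show "\<forall>m\<in>{..<M} - {..<Suc (nat i)}. fls_nth (fps_nth (f m) k) i = 0"
          using assms False by (auto simp: coeffs_ord_ge_def)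
      qed (use i False in auto)
      then show ?thesis using False by simp
    qed
    then show "fls_nth (fps_nth (?s - (\<Sum>m<M. f m)) k) i = 0"
      by (simp only: fps_sub_nth fls_minus_nth s fps_sum_nth fls_nth_sum) simp
  qed
qed

lemma coeffwise_sumsI:
  assumes "\<And>M. coeffs_ord_ge (int M) (s - (\<Sum>m<M. f m))"
  shows "coeffwise_sums f s"
  unfolding coeffwise_sums_def sums_def
proof (intro allI metric_LIMSEQ_I)
  fix k and e :: real assume "e > 0"
  then obtain N where N: "(1 / 2) ^ N < e"
    using real_arch_pow_inv[of e "1 / 2"] by auto
  show "\<exists>N. \<forall>n\<ge>N. dist (\<Sum>m<n. fps_nth (f m) k) (fps_nth s k) < e"
  proof (intro exI allI impI)
    fix n assume n: "n \<ge> N"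
    let ?d = "(\<Sum>m<n. fps_nth (f m) k) - fps_nth s k"
    show "dist (\<Sum>m<n. fps_nth (f m) k) (fps_nth s k) < e"
    proof (cases "?d = 0")
      case False
      have "fls_nth ?d i = 0" if "i < int n" for i
      proof -
        have "fls_nth (fps_nth (s - (\<Sum>m<n. f m)) k) i = 0"
          using assms[of n] that unfolding coeffs_ord_ge_def by blast
        then show ?thesis by (simp add: fps_sum_nth)
      qed
      with False have "int n \<le> fls_subdegree ?d"
        by (intro fls_subdegree_geI) auto
      moreover from this have "N \<le> nat (fls_subdegree ?d)"
        using n by linarith
      ultimately have "dist (\<Sum>m<n. fps_nth (f m) k) (fps_nth s k) = (1 / 2) ^ nat (fls_subdegree ?d)"
        using False by (simp add: dist_fls_def power_one_over inverse_eq_divide)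
      also have "\<dots> \<le> (1 / 2) ^ N"
        using \<open>N \<le> nat (fls_subdegree ?d)\<close> by (intro power_decreasing) auto
      finally show ?thesis using N by simp
    qed (use \<open>e > 0\<close> in simp)
  qed
qed

lemma des_le: "des n p \<le> n"
  unfolding des_def by (rule order.trans[OF card_mono[of "{..<n}"]]) auto

lemma fls_subdegree_1_minus_const: "(c::'a::field) \<noteq> 1 \<Longrightarrow> fls_subdegree (1 - fls_const c) = 0"
  by (intro fls_subdegree_eqI) auto

lemma one_minus_fls_const_nonzero: "(c::'a::field) \<noteq> 1 \<Longrightarrow> 1 - fls_const c \<noteq> 0"
  by (auto simp: fls_eq_iff)

text \<open>Expanding each quotient by \<open>(1/u)^n\<close> turns \<open>(1 - u)^n\<close> into
  \<open>(1/u - 1)^n\<close>, a unit at \<open>1/u = 0\<close>. The numerator keeps nonnegative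
  order, as there are at most \<open>n\<close> descents.\<close>

lemma coeffs_ord_ge_gf:
  fixes x v z :: "'a::field fls fps"
  assumes x: "coeffs_ord_ge 0 x" "fps_nth x 0 = fls_const x0" "x0 \<noteq> 1"
    and v: "coeffs_ord_ge 0 v" and z: "coeffs_ord_ge 0 z"
  shows "coeffs_ord_ge 0 (gf x indet_u v 1 z)"
proof -
  let ?u = "indet_u :: 'a fls fps" and ?w = "fps_const fls_X :: 'a fls fps"
  have wu: "?w * ?u = 1" by (simp add: fls_X_times_conv_shift fls_X_inv_conv_shift_1)
  have summand: "coeffs_ord_ge 0 (gf_summand x ?u v 1 z n)" for n
    unfolding gf_summand_def
  proof (rule coeffs_ord_ge_sum)
    fix p
    define A where "A = ?u ^ des n p * x ^ ides n p * 1 ^ lmin n p * v ^ rmax n p * z ^ lmax n p"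
    define B where "B = (1 - ?u) ^ n * (1 - x) ^ n"
    define h where "h = (?w - 1) ^ n * (1 - x) ^ n"
    have h: "?w ^ n * B = h"
    proof -
      have "?w * (1 - ?u) = ?w - 1"
        by (simp only: right_diff_distrib wu mult_1_right)
      then show ?thesis
        unfolding B_def h_def by (simp only: mult.assoc[symmetric] power_mult_distrib[symmetric])
    qed
    have h0: "fps_nth h 0 = (fls_X - 1) ^ n * (1 - fls_const x0) ^ n"
      by (simp add: h_def fps_power_zeroth x(2))
    have sub: "fls_subdegree (fls_X - 1 :: 'a fls) = 0"
      by (intro fls_subdegree_eqI) auto
    have ne: "fls_X - 1 \<noteq> (0 :: 'a fls)"
      by (auto simp: fls_eq_iff intro!: exI[of _ 0])
    have h0': "fps_nth h 0 \<noteq> 0" "fls_subdegree (fps_nth h 0) = 0"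
      unfolding h0 using ne sub fls_subdegree_1_minus_const[OF x(3)] one_minus_fls_const_nonzero[OF x(3)]
      by (simp_all add: fls_subdegree_pow)
    have B0: "fps_nth B 0 \<noteq> 0"
      using h0' h by (metis fps_mult_nth_0 mult_zero_right)
    have "A / B * h = ?w ^ n * (A / B * B)"
      by (simp only: h[symmetric] ac_simps)
    also have "A / B * B = A"
      using B0 by (simp add: fps_divide_unit mult.assoc inverse_mult_eq_1)
    also have "?w ^ n * A = ?w ^ (n - des n p) * (x ^ ides n p * v ^ rmax n p * z ^ lmax n p)"
    proof -
      have "?w ^ n = ?w ^ (n - des n p) * ?w ^ des n p"
        using des_le[of n p] by (simp only: power_add[symmetric] le_add_diff_inverse2)
      moreover have "?w ^ des n p * ?u ^ des n p = 1"
        by (simp only: power_mult_distrib[symmetric] wu power_one)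
      moreover have "(a * b) * (c * d * 1 * e * f) = a * ((b * c) * (d * e * f))" for a b c d e f :: "'a fls fps"
        by (simp only: ac_simps mult_1_left mult_1_right)
      ultimately show ?thesis
        unfolding A_def by (simp only: power_one mult_1_left)
    qed
    finally have AB: "A / B * h = ?w ^ (n - des n p) * (x ^ ides n p * v ^ rmax n p * z ^ lmax n p)" .
    have w: "coeffs_ord_ge 0 ?w"
      by (rule coeffs_ord_ge_mono[OF coeffs_ord_ge_fls_X]) simp
    have "coeffs_ord_ge 0 (A / B * h)"
      unfolding AB by (intro coeffs_ord_ge_mult_le[of 0 _ 0] coeffs_ord_ge_power w x(1) v z) simp_all
    moreover have "coeffs_ord_ge 0 h"
      unfolding h_def
      by (intro coeffs_ord_ge_mult_le[of 0 _ 0] coeffs_ord_ge_power coeffs_ord_ge_diff coeffs_ord_ge_one w x(1)) simp_all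
    ultimately show "coeffs_ord_ge 0 (A / B)"
      using h0' by (rule coeffs_ord_ge_cancel)
  qed
  show ?thesis
    unfolding coeffs_ord_ge_def gf_nth fls_nth_sum
    using summand by (auto simp: coeffs_ord_ge_def intro!: sum.neutral)
qed

section \<open>The quotient formula\<close>

text \<open>At \<open>z = 1\<close> the equation has the common factor
  \<open>(1 - t) (1 - x)\<close> on the right. Both sides of the claim reduce to
  \<open>- u v t (1 + (1 - t) x g')\<close>.\<close>

lemma functional_equation_difference:
  fixes u :: "'a::idom"
  assumes "u * (1 - x + x * v * t) * g = (1 - t - x * (1 - t)) * g' - v * t"
    and "u * (1 - x * (1 - t) + x * (1 - t) * v * t) * g' = (1 - t - x * (1 - t) * (1 - t)) * g'' - v * t"
    and "b = u * g - (1 - t) * g'" "b' = u * g' - (1 - t) * g''"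
  shows "u * (1 - x + x * v * t) * b = (1 - x * (1 - t)) * b' - v * t * (u - 1)"
  using assms by algebra

lemma functional_equation_partial_sum:
  fixes p b :: "nat \<Rightarrow> 'a::idom"
  assumes b: "\<And>m. u * (1 - x * r ^ m + x * r ^ m * v * t) * b m = (1 - x * r ^ m * r) * b (Suc m) - v * t * (u - 1)"
    and p: "\<And>m. p (Suc m) * (u * (r ^ Suc m - 1)) = p m * (c * r ^ m - 1)"
  shows "u * (1 - x + x * v * t) * (\<Sum>m<M. p m * r ^ m * b m) - (c - x * r) * (\<Sum>m<M. p m * r ^ m * b (Suc m)) =
    - (u * (r ^ M - 1) * p M * b M) - v * t * (u - 1) * (\<Sum>m<M. p m)"
proof (induction M)
  case (Suc M)
  have step: "u * (1 - x + x * v * t) * (S + q * y * d) - (c - x * r) * (S' + q * y * d') =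
      - (q' * (u * (y * r - 1)) * d') - v * t * (u - 1) * (w + q)"
    if "u * (1 - x + x * v * t) * S - (c - x * r) * S' = - (u * (y - 1) * q * d) - v * t * (u - 1) * w"
      "u * (1 - x * y + x * y * v * t) * d = (1 - x * y * r) * d' - v * t * (u - 1)"
      "q' * (u * (y * r - 1)) = q * (c * y - 1)" for S S' q q' y d d' w
    using that by algebra
  have "p (Suc M) * (u * (r ^ M * r - 1)) = p M * (c * r ^ M - 1)"
    using p[of M] by (simp only: power_Suc2)
  from step[OF Suc b[of M] this] show ?case
    by (simp only: sum.lessThan_Suc power_Suc2 ac_simps)
qed simp

text \<open>The inhomogeneous terms cancel because \<open>w (u - 1) = 1 - w\<close>; only the
  boundary term survives. The factor \<open>w\<close> on the right makes the equation
  contracting.\<close>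

lemma functional_equation_combine:
  fixes u :: "'a::idom"
  assumes wu: "w * u = 1"
    and H: "u * a * H - k * H' = - (u * s * p * b) - v * t * (u - 1) * S"
    and G: "u * a * G = k * G' - v * z * t"
  shows "(z * w * H - (1 - w) * S * G) * a = w * (k * (z * w * H' - (1 - w) * S * G') - z * (s * p * b))"
proof -
  have "(z * w * H - (1 - w) * S * G) * a = (w * u) * ((z * w * H - (1 - w) * S * G) * a)"
    by (simp add: wu)
  also have "\<dots> = w * (z * w * (u * a * H) - (1 - w) * S * (u * a * G))"
    by (simp add: algebra_simps)
  also have "u * a * H = k * H' - u * s * p * b - v * t * (u - 1) * S"
    using H by (simp add: algebra_simps)
  also have "w * (z * w * (k * H' - u * s * p * b - v * t * (u - 1) * S) - (1 - w) * S * (u * a * G)) =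
      w * (z * w * k * H' - z * ((w * u) * (s * p * b)) - z * v * t * S * (w * u - w) - (1 - w) * S * (u * a * G))"
    by (simp add: algebra_simps)
  also have "\<dots> = w * (k * (z * w * H' - (1 - w) * S * G') - z * (s * p * b))"
    unfolding wu G by (simp add: algebra_simps)
  finally show ?thesis .
qed

text \<open>The divisor is not a unit, but its factor \<open>fps_X\<close> also occurs in the
  numerator, so the division is exact.\<close>

lemma fps_X_div_cancel:
  fixes h :: "'a::field fps"
  assumes "fps_nth h 0 \<noteq> 0"
  shows "(fps_X * n) / (fps_X * h) * (fps_X * h) = fps_X * n"
proof -
  have "inverse h * h = 1" using assms by (rule inverse_mult_eq_1)
  then have "fps_X * n = (fps_X * h) * (n * inverse h)"
    by (simp add: ac_simps)
  then have "fps_X * h dvd fps_X * n" by (rule dvdI)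
  then show ?thesis by (rule dvd_div_mult_self)
qed

theorem theorem4:
  fixes x0 v0 z0 :: "'a::field_char_0"
    and t r u x v z :: "'a fls fps"
    and T P :: "nat \<Rightarrow> 'a fls fps"
  assumes "x0 \<noteq> 1"
    and "x = scalar x0" and "v = scalar v0" and "z = scalar z0" and "u = indet_u"
    and "t = fps_X" and "r = 1 - t"
    and "\<And>n. T n = r ^ (n - 1) * gf (x * r ^ (n - 1)) u v 1 1"
    and "\<And>n. P n = (\<Prod>i = 1..n - 1. (t * (1 - z) * r ^ (i - 1) + r ^ i - 1) / (u * (r ^ i - 1)))"
  shows "\<exists>N D.
      coeffwise_sums (\<lambda>m. let n = Suc m in
          z * t * v * r ^ (n - 1) * (1 + u * x * T n) / (u * (x * r ^ (n - 1) - 1)) * P n) N \<and>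
      coeffwise_sums (\<lambda>m. let n = Suc m in
          t * (z - 1) * r ^ (n - 1) / (u * (r ^ n - 1)) * P n) D \<and>
      fps_nth (1 - D) 0 \<noteq> 0 \<and>
      gf x u v 1 z = N * inverse (1 - D)"
proof -
  note x = assms(2) and v = assms(3) and z = assms(4) and u = assms(5) and t = assms(6) and r = assms(7)
  \<comment> \<open>\<open>w\<close> is \<open>1/u\<close>, and \<open>p\<close> is \<open>P\<close>
    indexed from 0. The index \<open>j\<close> counts how often \<open>x\<close> has been replaced
    by \<open>x r\<close>.\<close>
  define w :: "'a fls fps" where "w = fps_const fls_X"
  define c where "c = 1 - z * t"
  define p where "p m = P (Suc m)" for m
  define y where "y j = x * r ^ j" for j
  define G where "G j = gf (y j) u v 1 z" for j
  define G1 where "G1 j = gf (y j) u v 1 1" for j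
  define B where "B j = u * G1 j - r * G1 (Suc j)" for j
  \<comment> \<open>The quotient of \<open>r^i - 1\<close> by \<open>t\<close>. Its constant term
    \<open>- i\<close> is nonzero for \<open>i > 0\<close> in characteristic 0.\<close>
  define unit where "unit i = - (\<Sum>j<i. r ^ j)" for i

  have wu: "w * u = 1" 
    by (simp add: w_def u fls_X_times_conv_shift fls_X_inv_conv_shift_1)
  have u_nz: "u \<noteq> 0" using wu by auto
  have r0: "fps_nth (r ^ j) 0 = 1" for j by (simp add: r t fps_power_zeroth)
  have y0: "fps_nth (y j) 0 = fls_const x0" for j by (simp add: y_def x fps_mult_nth_0 r0)
  have y0': "fps_nth (y j) 0 \<noteq> 1" for j
    unfolding y0 using one_minus_fls_const_nonzero[OF assms(1)] by auto
  have u_ne: "fls_X_inv \<noteq> (1 :: 'a fls)" by (auto simp: fls_eq_iff intro!: exI[of _ 0])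

  \<comment> \<open>Orders of the ingredients in \<open>1/u\<close>\<close>
  have ord_t: "coeffs_ord_ge 0 t" unfolding t by (rule coeffs_ord_ge_X)
  have ord_r: "coeffs_ord_ge 0 (r ^ j)" for j
    unfolding r by (intro coeffs_ord_ge_power coeffs_ord_ge_diff coeffs_ord_ge_one ord_t)
  have ord_v: "coeffs_ord_ge 0 v" and ord_z: "coeffs_ord_ge 0 z" and ord_x: "coeffs_ord_ge 0 x"
    unfolding v z x by (rule coeffs_ord_ge_scalar)+
  have ord_y: "coeffs_ord_ge 0 (y j)" for j
    unfolding y_def by (rule coeffs_ord_ge_mult_le[OF ord_x ord_r]) simp
  have ord_w: "coeffs_ord_ge 1 w" unfolding w_def by (rule coeffs_ord_ge_fls_X)
  have ord_u: "coeffs_ord_ge (-1) u" unfolding u by (rule coeffs_ord_ge_fls_X_inv)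
  have ord_G: "coeffs_ord_ge 0 (G j)" for j
    unfolding G_def u by (rule coeffs_ord_ge_gf[OF ord_y y0 assms(1) ord_v ord_z])
  have ord_G1: "coeffs_ord_ge 0 (G1 j)" for j
    unfolding G1_def u by (rule coeffs_ord_ge_gf[OF ord_y y0 assms(1) ord_v coeffs_ord_ge_one])
  have ord_B: "coeffs_ord_ge (-1) (B j)" for j
    unfolding B_def
    by (intro coeffs_ord_ge_diff coeffs_ord_ge_mult_le[OF ord_u ord_G1] coeffs_ord_ge_mult_le[OF ord_r[of 1, simplified] ord_G1]) simp_all

  \<comment> \<open>Functional equations of the specialized series\<close>
  have y_Suc: "y (Suc j) = y j * (1 - t)" for j
    by (simp add: y_def r)
  have EG: "u * (1 - y j + y j * v * t) * G j = (c - y j * r) * G (Suc j) - v * z * t" for j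
    using gf_functional_equation[OF u_ne y0', of j "fls_const v0" "fls_const z0"]
    unfolding G_def y_Suc u v z t c_def r by (simp only:)
  have EG1: "u * (1 - y j + y j * v * t) * G1 j = (1 - t - y j * (1 - t)) * G1 (Suc j) - v * t" for j
    using gf_functional_equation[OF u_ne y0', of j "fls_const v0" 1]
    unfolding G1_def y_Suc u v t by (simp only: fps_const_1_eq_1 mult_1_left mult_1_right)
  have EB: "u * (1 - y j + y j * v * t) * B j = (1 - y j * r) * B (Suc j) - v * t * (u - 1)" for j
    unfolding r using functional_equation_difference[OF EG1[of j] EG1[of "Suc j", unfolded y_Suc] B_def[of j, unfolded r] B_def[of "Suc j", unfolded r]] .
  \<comment> \<open>The factor \<open>1 + u x T n\<close> of the numerator becomes a multiple of
    \<open>B\<close>, and \<open>y j - 1\<close> will cancel against the denominator of the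
    summand.\<close>
  have vt: "v * t * (1 + u * y j * G1 j) = (y j - 1) * B j" for j
    using EG1[of j] unfolding B_def r by algebra

  \<comment> \<open>The factors of the products \<open>P\<close>\<close>
  have r_unit: "r ^ i - 1 = t * unit i" for i
    using one_diff_power_eq[of r i] unfolding unit_def r by (simp add: algebra_simps)
  have unit0: "fps_nth (unit i) 0 = fls_const (- of_nat i)" for i
    by (simp add: unit_def fps_sum_nth r0 fls_of_nat)
  have unit0': "fps_nth (unit i) 0 \<noteq> 0" "fls_subdegree (fps_nth (unit i) 0) = 0" if "i > 0" for i
    unfolding unit0 using that by auto
  have ord_unit: "coeffs_ord_ge 0 (unit i)" for i
    unfolding unit_def using coeffs_ord_ge_diff[OF coeffs_ord_ge_zero coeffs_ord_ge_sum[OF ord_r]] by simp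
  have div: "(t * n) / (u * (r ^ i - 1)) * (u * (r ^ i - 1)) = t * n" if "i > 0" for i n
  proof -
    have "u * (r ^ i - 1) = t * (u * unit i)" by (simp add: r_unit ac_simps)
    moreover have "fps_nth (u * unit i) 0 \<noteq> 0" using unit0'[OF that] by (simp add: u)
    ultimately show ?thesis using fps_X_div_cancel unfolding t by metis
  qed

  have p_0: "p 0 = 1" by (simp add: p_def assms(9))
  define f where "f i = (t * (1 - z) * r ^ (i - 1) + r ^ i - 1) / (u * (r ^ i - 1))" for i
  have p_Suc_f: "p (Suc m) = p m * f (Suc m)" for m
    by (simp add: p_def assms(9) f_def)
  have f_num: "t * (1 - z) * r ^ (Suc m - 1) + r ^ Suc m - 1 = c * r ^ m - 1" for m
    unfolding c_def r by (simp add: algebra_simps)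
  have f_num': "c * r ^ m - 1 = t * (unit m - z * r ^ m)" for m
    using r_unit[of m] unfolding c_def by (simp add: algebra_simps)
  have f_eq: "f (Suc m) * (u * (r ^ Suc m - 1)) = c * r ^ m - 1" for m
    unfolding f_def f_num f_num' by (rule div) simp
  have p_Suc: "p (Suc m) * (u * (r ^ Suc m - 1)) = p m * (c * r ^ m - 1)" for m
    unfolding p_Suc_f mult.assoc f_eq ..
  \<comment> \<open>Once \<open>t\<close> is cancelled, the factor is
    \<open>w (unit m - z r^m)\<close> divided by a unit. Each factor thus adds an order in
    \<open>1/u\<close>, which makes the series over \<open>p\<close> converge.\<close>
  have ord_f: "coeffs_ord_ge 1 (f (Suc m))" for m
  proof (rule coeffs_ord_ge_cancel[OF _ ord_unit unit0'])
    have "t * (f (Suc m) * unit (Suc m)) = w * (f (Suc m) * (u * (r ^ Suc m - 1)))"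
    proof -
      have "t * (f (Suc m) * unit (Suc m)) = (w * u) * (t * (f (Suc m) * unit (Suc m)))"
        by (simp add: wu)
      then show ?thesis unfolding r_unit by (simp only: ac_simps)
    qed
    then have "t * (f (Suc m) * unit (Suc m)) = t * (w * (unit m - z * r ^ m))"
      unfolding f_eq f_num' by (simp only: ac_simps)
    moreover have "coeffs_ord_ge 1 (t * (w * (unit m - z * r ^ m)))"
      by (intro coeffs_ord_ge_mult_le[OF ord_t, of 1] coeffs_ord_ge_mult_le[OF ord_w, of 0]
        coeffs_ord_ge_diff ord_unit coeffs_ord_ge_mult_le[OF ord_z ord_r]) simp_all
    ultimately have "coeffs_ord_ge 1 (fps_X * (f (Suc m) * unit (Suc m)))"
      by (simp only: t)
    then show "coeffs_ord_ge 1 (f (Suc m) * unit (Suc m))"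
      by (rule coeffs_ord_ge_cancel_X)
  qed simp_all
  have ord_p: "coeffs_ord_ge (int m) (p m)" for m
  proof (induction m)
    case (Suc m)
    show ?case
      unfolding p_Suc_f by (rule coeffs_ord_ge_mult_le[OF Suc ord_f]) simp
  qed (simp add: p_0 coeffs_ord_ge_one)

  \<comment> \<open>The quotient formula for partial sums\<close>
  obtain \<phi> where \<phi>: "\<And>M. coeffs_ord_ge (int M) (\<phi> - (\<Sum>m<M. p m))"
    using coeffs_ord_ge_summable[OF ord_p] by blast
  define S where "S M = (\<Sum>m<M. p m)" for M
  define H where "H j M = (\<Sum>m<M. p m * r ^ m * B (j + m))" for j M
  \<comment> \<open>Partial numerator minus partial denominator times \<open>G j\<close>, to be
    shown to tend to 0. All \<open>j\<close> are treated together because the functional equation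
    raises \<open>j\<close>.\<close>
  define \<Delta> where "\<Delta> j M = z * w * H j M - (1 - w) * S M * G j" for j M

  have ord_S: "coeffs_ord_ge 0 (S M)" for M
    unfolding S_def by (intro coeffs_ord_ge_sum coeffs_ord_ge_mono[OF ord_p]) simp
  have ord_1w: "coeffs_ord_ge 0 (1 - w)"
    by (intro coeffs_ord_ge_diff coeffs_ord_ge_one coeffs_ord_ge_mono[OF ord_w]) simp
  have ord_H: "coeffs_ord_ge (-1) (H j M)" for j M
    unfolding H_def
    by (intro coeffs_ord_ge_sum coeffs_ord_ge_mult_le[OF _ ord_B, of 0] coeffs_ord_ge_mult_le[OF ord_p ord_r]) simp_all
  have ord_\<Delta>0: "coeffs_ord_ge 0 (\<Delta> j M)" for j M
    unfolding \<Delta>_def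
    by (intro coeffs_ord_ge_diff coeffs_ord_ge_mult_le[OF _ ord_H, of 1] coeffs_ord_ge_mult_le[OF ord_z ord_w]
      coeffs_ord_ge_mult_le[OF _ ord_G, of 0] coeffs_ord_ge_mult_le[OF ord_1w ord_S]) simp_all

  have H_eq: "u * (1 - y j + y j * v * t) * H j M - (c - y j * r) * H (Suc j) M =
    - (u * (r ^ M - 1) * p M * B (j + M)) - v * t * (u - 1) * S M" for j M
  proof -
    have "y (j + m) = y j * r ^ m" for m by (simp add: y_def power_add mult.assoc)
    then have "u * (1 - y j * r ^ m + y j * r ^ m * v * t) * B (j + m) =
        (1 - y j * r ^ m * r) * B (j + Suc m) - v * t * (u - 1)" for m
      using EB[of "j + m"] by simp
    from functional_equation_partial_sum[where b = "\<lambda>m. B (j + m)", OF this p_Suc, of M] show ?thesis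
      by (simp add: H_def S_def)
  qed
  have \<Delta>_eq: "\<Delta> j M * (1 - y j + y j * v * t) = w * ((c - y j * r) * \<Delta> (Suc j) M - z * ((r ^ M - 1) * p M * B (j + M)))" for j M
    unfolding \<Delta>_def by (rule functional_equation_combine[OF wu H_eq EG])
  \<comment> \<open>Each use of \<open>\<Delta>_eq\<close> gains one order from \<open>w\<close>.
    The boundary term has order at least \<open>M - 1\<close>, enough as long as
    \<open>Suc K \<le> M\<close>, and the factor \<open>1 - y j + y j * v * t\<close> is a unit
    because \<open>x0 \<noteq> 1\<close>.\<close>
  have ord_\<Delta>: "coeffs_ord_ge (int K) (\<Delta> j M)" if "K \<le> M" for j K M
    using that
  proof (induction K arbitrary: j)
    case (Suc K)
    have c: "coeffs_ord_ge 0 (c - y j * r)"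
      unfolding c_def
      by (intro coeffs_ord_ge_diff coeffs_ord_ge_one coeffs_ord_ge_mult_le[OF ord_z ord_t]
        coeffs_ord_ge_mult_le[OF ord_y ord_r[of 1, simplified]]) simp_all
    have "coeffs_ord_ge (int K) ((c - y j * r) * \<Delta> (Suc j) M)"
      by (rule coeffs_ord_ge_mult_le[OF c Suc.IH]) (use Suc.prems in simp_all)
    moreover have "coeffs_ord_ge (int K) (z * ((r ^ M - 1) * p M * B (j + M)))"
      using Suc.prems
      by (intro coeffs_ord_ge_mult_le[OF ord_z, of "int K"] coeffs_ord_ge_mult_le[OF _ ord_B, of "int M"]
        coeffs_ord_ge_mult_le[OF _ ord_p, of 0] coeffs_ord_ge_diff ord_r coeffs_ord_ge_one) simp_all
    ultimately have "coeffs_ord_ge (int (Suc K)) (\<Delta> j M * (1 - y j + y j * v * t))"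
      unfolding \<Delta>_eq by (intro coeffs_ord_ge_mult_le[OF ord_w, of "int K"] coeffs_ord_ge_diff) simp_all
    moreover have "coeffs_ord_ge 0 (1 - y j + y j * v * t)"
      by (intro coeffs_ord_ge_add coeffs_ord_ge_diff coeffs_ord_ge_one ord_y
        coeffs_ord_ge_mult_le[OF _ ord_t, of 0] coeffs_ord_ge_mult_le[OF ord_y ord_v]) simp_all
    moreover have "fps_nth (1 - y j + y j * v * t) 0 = 1 - fls_const x0"
      by (simp add: fps_mult_nth_0 y0 t)
    ultimately show ?case
      using coeffs_ord_ge_cancel fls_subdegree_1_minus_const[OF assms(1)] one_minus_fls_const_nonzero[OF assms(1)]
      by metis
  qed (simp add: ord_\<Delta>0)

  \<comment> \<open>The limits of numerator and denominator\<close>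
  define D where "D = 1 - (1 - w) * \<phi>"
  \<comment> \<open>Chosen as \<open>(1 - D) * G 0\<close>, so the formula holds at once; that the
    numerator series converges to it follows from \<open>ord_\<Delta>\<close>.\<close>
  define N where "N = (1 - w) * \<phi> * G 0"
  \<comment> \<open>\<open>t (z - 1) r^m\<close> is the difference of \<open>r^(m+1) - 1\<close> and
    \<open>c r^m - 1\<close>, so the recurrence of \<open>p\<close> splits the term, and its partial
    sums are \<open>1 - p M - (1 - w) * S M\<close>.\<close>
  have D_term: "t * (z - 1) * r ^ (Suc m - 1) / (u * (r ^ Suc m - 1)) * P (Suc m) = w * p m - p (Suc m)" for m
  proof -
    define q where "q = t * (z - 1) * r ^ m / (u * (r ^ Suc m - 1))"
    have q: "q * (u * (r ^ Suc m - 1)) = t * (z - 1) * r ^ m"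
      unfolding q_def mult.assoc by (rule div) simp
    have "u * (r ^ Suc m - 1) \<noteq> 0"
    proof -
      have "unit (Suc m) \<noteq> 0" using unit0'(1)[of "Suc m"] by auto
      then show ?thesis unfolding r_unit using u_nz by (simp add: t)
    qed
    moreover have "(q * p m - (w * p m - p (Suc m))) * (u * (r ^ Suc m - 1)) = 0"
    proof -
      let ?d = "r ^ Suc m - 1"
      have "(q * p m - (w * p m - p (Suc m))) * (u * ?d) =
          (q * (u * ?d)) * p m - (w * u) * (?d * p m) + p (Suc m) * (u * ?d)"
        by (simp only: algebra_simps)
      also have "\<dots> = 0"
        unfolding q p_Suc wu by (simp add: c_def r algebra_simps)
      finally show ?thesis .
    qed
    ultimately show ?thesis by (simp add: q_def p_def)
  qed
  have N_term: "z * t * v * r ^ (Suc m - 1) * (1 + u * x * T (Suc m)) / (u * (x * r ^ (Suc m - 1) - 1)) * P (Suc m) =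
      z * w * (p m * r ^ m * B m)" for m
  proof -
    have "u * x * T (Suc m) = u * y m * G1 m"
      by (simp add: assms(8) G1_def y_def mult.assoc)
    then have "z * t * v * r ^ (Suc m - 1) * (1 + u * x * T (Suc m)) = z * r ^ m * (v * t * (1 + u * y m * G1 m))"
      by (simp add: ac_simps)
    also have "\<dots> = (w * u) * (z * r ^ m * ((y m - 1) * B m))"
      unfolding vt wu by simp
    also have "\<dots> = (z * w * r ^ m * B m) * (u * (y m - 1))"
      by (simp only: ac_simps)
    finally have num: "z * t * v * r ^ (Suc m - 1) * (1 + u * x * T (Suc m)) = (z * w * r ^ m * B m) * (u * (y m - 1))" .
    have "y m - 1 \<noteq> 0" using y0'[of m] by auto
    then have "u * (y m - 1) \<noteq> 0" using u_nz by simp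
    then have "(z * w * r ^ m * B m) * (u * (y m - 1)) / (u * (y m - 1)) = z * w * r ^ m * B m"
      by (rule nonzero_mult_div_cancel_right)
    then show ?thesis
      unfolding num by (simp add: y_def p_def ac_simps)
  qed

  have "coeffwise_sums (\<lambda>m. w * p m - p (Suc m)) D"
  proof (rule coeffwise_sumsI)
    fix M
    have "(\<Sum>m<M. w * p m - p (Suc m)) = 1 - p M - (1 - w) * S M"
      by (induction M) (simp_all add: S_def p_0 algebra_simps)
    then have "D - (\<Sum>m<M. w * p m - p (Suc m)) = p M - (1 - w) * (\<phi> - S M)"
      by (simp only: D_def) (simp add: algebra_simps)
    then show "coeffs_ord_ge (int M) (D - (\<Sum>m<M. w * p m - p (Suc m)))"
      using coeffs_ord_ge_diff[OF ord_p[of M] coeffs_ord_ge_mult_le[OF ord_1w \<phi>[of M]]] by (simp add: S_def)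
  qed
  moreover have "coeffwise_sums (\<lambda>m. z * w * (p m * r ^ m * B m)) N"
  proof (rule coeffwise_sumsI)
    fix M
    have "(\<Sum>m<M. z * w * (p m * r ^ m * B m)) = z * w * H 0 M"
      by (simp add: H_def sum_distrib_left)
    then have "N - (\<Sum>m<M. z * w * (p m * r ^ m * B m)) = (1 - w) * (\<phi> - S M) * G 0 - \<Delta> 0 M"
      by (simp only: N_def \<Delta>_def) (simp add: algebra_simps)
    moreover have "coeffs_ord_ge (int M) ((1 - w) * (\<phi> - S M) * G 0)"
      unfolding S_def by (intro coeffs_ord_ge_mult_le[OF _ ord_G, of "int M"] coeffs_ord_ge_mult_le[OF ord_1w \<phi>]) simp_all
    ultimately show "coeffs_ord_ge (int M) (N - (\<Sum>m<M. z * w * (p m * r ^ m * B m)))"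
      using coeffs_ord_ge_diff ord_\<Delta>[of M M 0] by simp
  qed
  \<comment> \<open>Modulo \<open>1/u\<close> the limit \<open>\<phi>\<close> agrees with
    \<open>p 0 = 1\<close>, so its constant term in \<open>t\<close> is nonzero.\<close>
  moreover have D0: "fps_nth (1 - D) 0 \<noteq> 0"
  proof -
    have "fls_nth (fps_nth (\<phi> - (\<Sum>m<1. p m)) 0) 0 = 0"
      using \<phi>[of 1] by (simp add: coeffs_ord_ge_def)
    then have "fps_nth \<phi> 0 \<noteq> 0" by (auto simp: p_0)
    moreover have "1 - fls_X \<noteq> (0 :: 'a fls)"
      by (auto simp: fls_eq_iff intro!: exI[of _ 0])
    ultimately show ?thesis by (simp add: D_def w_def fps_mult_nth_0)
  qed
  moreover have "gf x u v 1 z = N * inverse (1 - D)"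
  proof -
    have "N = (1 - D) * G 0" by (simp add: N_def D_def)
    then have "N * inverse (1 - D) = G 0 * ((1 - D) * inverse (1 - D))"
      by (simp only: ac_simps)
    also have "(1 - D) * inverse (1 - D) = 1" using D0 by (rule inverse_mult_eq_1')
    finally show ?thesis by (simp add: G_def y_def)
  qed
  ultimately show ?thesis
    unfolding Let_def N_term D_term by blast
qed

end
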